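(* Let $(A,\mathfrak m)$ be a one-dimensional Cohen-Macaulay local ring with infinite residue field and reduction number $r$, and let $xA$ be a minimal reduction of $\mathfrak m$. Let $\alpha_i,\alpha_{i,j}$ be the invariants of the tangent cone with respect to $x$ and $\gamma_i$ the Apery invariants of $A$ with respect to $x$. For $1\le i\le r$, $$\alpha_i+\sum_{j=1}^{r-i-1}\alpha_{i,j}=\gamma_i+\lambda\left(\frac{\mathfrak m^{i}\cap xA+\mathfrak m^{i+1}}{x\mathfrak m^{i-1}+\mathfrak m^{i+1}}\right).$$
   Context: $\lambda$ denotes length of $A$-modules and $\mathfrak m^0=A$. $K=A/\mathfrak m$. Empty sums are $0$. The tangent cone is $G(\mathfrak m)=\bigoplus_{n\ge 0}\mathfrak m^n/\mathfrak m^{n+1}$. An ideal $xA$ with $x\in\mathfrak m$ is a minimal reduction of $\mathfrak m$ if $\mathfrak m^{n+1}=x\mathfrak m^n$ for some $n$; the reduction number $r$ is the least integer $r\ge 0$ with $\mathfrak m^{r+1}=x\mathfrak m^r$ (independent of the choice of $x$). Invariants of the tangent cone: let $F(x)=\bigoplus_{n\ge 0}x^nA/x^n\mathfrak m\hookrightarrow G(\mathfrak m)$, a polynomial ring $K[x^*]$ in the initial form $x^*\in\mathfrak m/\mathfrak m^2$. As a graded $F(x)$-module, $$G(\mathfrak m)\cong\bigoplus_{i=0}^{r}\left(F(x)(-i)\right)^{\alpha_i}\oplus\bigoplus_{i=1}^{r-1}\bigoplus_{j=1}^{r-i}\left(\frac{F(x)}{(x^* )^jF(x)}(-i)\right)^{\alpha_{i,j}}$$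 for uniquely determined non-negative integers $\alpha_i,\alpha_{i,j}$ (with $\alpha_0=1$). Apery invariants with respect to $x$: $\gamma_i=\lambda\left(\dfrac{\mathfrak m^i+xA}{\mathfrak m^{i+1}+xA}\right)$. *)

theory Defs
  imports "HOL-Algebra.Algebra" "HOL-Library.Extended_Nat"
begin

section \<open>Local rings, dimension, depth\<close>

locale noetherian_local_ring = noetherian_ring A + cring A for A (structure) +
  fixes m
  assumes maximalideal_iff: "maximalideal I A \<longleftrightarrow> I = m"

definition krull_dim :: "('a, 'b) ring_scheme \<Rightarrow> enat" where
  "krull_dim A = Sup {enat n | n P. (\<forall>i\<le>n. primeideal (P i) A) \<and> (\<forall>i<n. P i \<subset> P (Suc i))}"

text \<open>The first clause says that \<open>xs ! i\<close> is a nonzerodivisor on the quotient of \<open>A\<close> by the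
  ideal generated by the preceding entries.\<close>

definition regular_sequence :: "('a, 'b) ring_scheme \<Rightarrow> 'a list \<Rightarrow> bool" where
  "regular_sequence A xs \<longleftrightarrow> set xs \<subseteq> carrier A \<and>
     (\<forall>i<length xs. \<forall>a\<in>carrier A.
        xs ! i \<otimes>\<^bsub>A\<^esub> a \<in> genideal A (set (take i xs)) \<longrightarrow> a \<in> genideal A (set (take i xs))) \<and>
     genideal A (set xs) \<noteq> carrier A"

definition depth :: "('a, 'b) ring_scheme \<Rightarrow> 'a set \<Rightarrow> enat" where
  "depth A m = Sup {enat (length xs) | xs. set xs \<subseteq> m \<and> regular_sequence A xs}"

definition cohen_macaulay_local_ring :: "('a, 'b) ring_scheme \<Rightarrow> 'a set \<Rightarrow> bool" where
  "cohen_macaulay_local_ring A m \<longleftrightarrow> noetherian_local_ring A m \<and> depth A m = krull_dim A"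


section \<open>Quotient modules and length\<close>

text \<open>The record \<^typ>\<open>('a, 'b) module\<close> extends the ring record. Where a module carries no
  multiplication, the fields \<open>mult\<close> and \<open>one\<close> are left \<^const>\<open>undefined\<close>; neither the locale
  \<^locale>\<open>module\<close> nor \<^locale>\<open>submodule\<close> looks at them.\<close>

definition quot_module :: "('a, 'b, 'c) module_scheme \<Rightarrow> 'b set \<Rightarrow> ('a, 'b set) module" where
  "quot_module M N =
     \<lparr>carrier = a_rcosets\<^bsub>M\<^esub> N, monoid.mult = undefined, one = undefined,
      ring.zero = N, ring.add = set_add M,
      smult = (\<lambda>a Y. \<Union>y\<in>Y. N +>\<^bsub>M\<^esub> (a \<odot>\<^bsub>M\<^esub> y))\<rparr>"

definition module_length ::
    "('a, 'r) ring_scheme \<Rightarrow> ('a, 'b, 'c) module_scheme \<Rightarrow> enat" where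
  "module_length R M =
     Sup {enat n | n N. (\<forall>i\<le>n. submodule (N i) R M) \<and> (\<forall>i<n. N i \<subset> N (Suc i))}"

definition ideal_module :: "('a, 'b) ring_scheme \<Rightarrow> 'a set \<Rightarrow> ('a, 'a) module" where
  "ideal_module A I =
     \<lparr>carrier = I, monoid.mult = monoid.mult A, one = \<one>\<^bsub>A\<^esub>,
      ring.zero = \<zero>\<^bsub>A\<^esub>, ring.add = ring.add A, smult = monoid.mult A\<rparr>"

text \<open>The length of the \<open>A\<close>-module \<open>I / J\<close>, for ideals \<open>J \<subseteq> I\<close>.\<close>

definition quot_length :: "('a, 'b) ring_scheme \<Rightarrow> 'a set \<Rightarrow> 'a set \<Rightarrow> enat" where
  "quot_length A I J = module_length A (quot_module (ideal_module A I) J)"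


section \<open>Graded modules\<close>

record ('a, 'b) gmodule = "('a, 'b) module" +
  hcomp :: "nat \<Rightarrow> 'b set"  \<comment> \<open>homogeneous components\<close>

text \<open>\<open>M(-i)\<close>: its component of degree \<open>n\<close> is the component of \<open>M\<close> of degree \<open>n - i\<close>.\<close>

definition gshift :: "('a, 'b) gmodule \<Rightarrow> nat \<Rightarrow> ('a, 'b) gmodule" where
  "gshift M i = M\<lparr>hcomp := (\<lambda>n. if i \<le> n then hcomp M (n - i) else {\<zero>\<^bsub>M\<^esub>})\<rparr>"

definition gquot :: "('a, 'b) gmodule \<Rightarrow> 'b set \<Rightarrow> ('a, 'b set) gmodule" where
  "gquot M N = module.extend (quot_module M N)
     (gmodule.fields (\<lambda>n. (\<lambda>y. N +>\<^bsub>M\<^esub> y) ` hcomp M n))"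

definition gdirect_sum :: "'i set \<Rightarrow> ('i \<Rightarrow> ('a, 'b) gmodule) \<Rightarrow> ('a, 'i \<Rightarrow> 'b) gmodule" where
  "gdirect_sum I M =
     (let C = {f \<in> (\<Pi>\<^sub>E i\<in>I. carrier (M i)). finite {i \<in> I. f i \<noteq> \<zero>\<^bsub>M i\<^esub>}} in
     \<lparr>carrier = C, monoid.mult = undefined, one = undefined,
      ring.zero = (\<lambda>i\<in>I. \<zero>\<^bsub>M i\<^esub>),
      ring.add = (\<lambda>f g. \<lambda>i\<in>I. f i \<oplus>\<^bsub>M i\<^esub> g i),
      smult = (\<lambda>a f. \<lambda>i\<in>I. a \<odot>\<^bsub>M i\<^esub> f i),
      hcomp = (\<lambda>n. {f \<in> C. \<forall>i\<in>I. f i \<in> hcomp (M i) n})\<rparr>)"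

definition gdirect_sum2 ::
    "('a, 'b) gmodule \<Rightarrow> ('a, 'c) gmodule \<Rightarrow> ('a, 'b \<times> 'c) gmodule" where
  "gdirect_sum2 M N =
     \<lparr>carrier = carrier M \<times> carrier N, monoid.mult = undefined, one = undefined,
      ring.zero = (\<zero>\<^bsub>M\<^esub>, \<zero>\<^bsub>N\<^esub>),
      ring.add = (\<lambda>(y, z) (y', z'). (y \<oplus>\<^bsub>M\<^esub> y', z \<oplus>\<^bsub>N\<^esub> z')),
      smult = (\<lambda>a (y, z). (a \<odot>\<^bsub>M\<^esub> y, a \<odot>\<^bsub>N\<^esub> z)),
      hcomp = (\<lambda>n. hcomp M n \<times> hcomp N n)\<rparr>"

definition gmodule_iso ::
    "('a, 'r) ring_scheme \<Rightarrow> ('a, 'b) gmodule \<Rightarrow> ('a, 'c) gmodule \<Rightarrow> bool" where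
  "gmodule_iso R M N \<longleftrightarrow>
     (\<exists>h. bij_betw h (carrier M) (carrier N) \<and>
        (\<forall>y\<in>carrier M. \<forall>z\<in>carrier M. h (y \<oplus>\<^bsub>M\<^esub> z) = h y \<oplus>\<^bsub>N\<^esub> h z) \<and>
        (\<forall>a\<in>carrier R. \<forall>y\<in>carrier M. h (a \<odot>\<^bsub>M\<^esub> y) = a \<odot>\<^bsub>N\<^esub> h y) \<and>
        (\<forall>n. h ` hcomp M n = hcomp N n))"


section \<open>The tangent cone and the fiber cone\<close>

text \<open>Powers are taken in the structure of ideals of \<open>A\<close>, whose unit is
  \<open>carrier A\<close>.\<close>

abbreviation ideal_pow :: "('a, 'b) ring_scheme \<Rightarrow> 'a set \<Rightarrow> nat \<Rightarrow> 'a set" where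
  "ideal_pow A I n \<equiv> I [^]\<^bsub>ideals_set A\<^esub> n"

text \<open>Multiplication of sequences of cosets, \<open>(f g)\<^sub>n = \<Sum>\<^sub>i f\<^sub>i g\<^sub>n\<^sub>-\<^sub>i\<close> modulo \<open>Q n\<close>. The entries of
  \<open>f\<close> need not be cosets of the ideals \<open>Q i\<close> themselves: cosets of smaller ideals also
  multiply into cosets of \<open>Q n\<close>.\<close>

definition coset_conv ::
    "('a, 'b) ring_scheme \<Rightarrow> (nat \<Rightarrow> 'a set) \<Rightarrow> (nat \<Rightarrow> 'a set) \<Rightarrow> (nat \<Rightarrow> 'a set) \<Rightarrow> nat \<Rightarrow> 'a set"
  where "coset_conv A Q f g =
    (\<lambda>n. \<Oplus>\<^bsub>A Quot Q n\<^esub>i\<in>{..n}. rcoset_mult A (Q n) (f i) (g (n - i)))"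

text \<open>\<open>\<Oplus>\<^sub>n P n / Q n\<close> for ideals \<open>Q n \<subseteq> P n\<close> with \<open>P i P j \<subseteq> P (i + j)\<close> and
  \<open>P i Q j \<subseteq> Q (i + j)\<close>, as a graded ring. Its elements are the finitely supported sequences
  of cosets. The scalar multiplication \<open>smult\<close> agrees with the ring multiplication when the scalars
  come from this ring, but it is also the action of any other such \<open>\<Oplus>\<^sub>n P' n / Q' n\<close> with
  \<open>P' n \<subseteq> P n\<close> and \<open>Q' n \<subseteq> Q n\<close> through the natural map
  \<open>P' n / Q' n \<rightarrow> P n / Q n\<close>.\<close>

definition graded_ring_of ::
    "('a, 'b) ring_scheme \<Rightarrow> (nat \<Rightarrow> 'a set) \<Rightarrow> (nat \<Rightarrow> 'a set) \<Rightarrow>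
       (nat \<Rightarrow> 'a set, nat \<Rightarrow> 'a set) gmodule" where
  "graded_ring_of A P Q =
     (let C = {f. (\<forall>n. f n \<in> (\<lambda>a. Q n +>\<^bsub>A\<^esub> a) ` P n) \<and> finite {n. f n \<noteq> Q n}} in
     \<lparr>carrier = C,
      monoid.mult = coset_conv A Q,
      one = (\<lambda>n. if n = 0 then Q 0 +>\<^bsub>A\<^esub> \<one>\<^bsub>A\<^esub> else Q n),
      ring.zero = Q,
      ring.add = (\<lambda>f g n. f n <+>\<^bsub>A\<^esub> g n),
      smult = coset_conv A Q,
      hcomp = (\<lambda>k. {f \<in> C. \<forall>n. n \<noteq> k \<longrightarrow> f n = Q n})\<rparr>)"

definition tangent_cone ::
    "('a, 'b) ring_scheme \<Rightarrow> 'a set \<Rightarrow> (nat \<Rightarrow> 'a set, nat \<Rightarrow> 'a set) gmodule" where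
  "tangent_cone A m = graded_ring_of A (\<lambda>n. ideal_pow A m n) (\<lambda>n. ideal_pow A m (n + 1))"

definition fiber_cone ::
    "('a, 'b) ring_scheme \<Rightarrow> 'a set \<Rightarrow> 'a \<Rightarrow> (nat \<Rightarrow> 'a set, nat \<Rightarrow> 'a set) gmodule" where
  "fiber_cone A m x = graded_ring_of A
     (\<lambda>n. (x [^]\<^bsub>A\<^esub> n) <#\<^bsub>A\<^esub> carrier A) (\<lambda>n. (x [^]\<^bsub>A\<^esub> n) <#\<^bsub>A\<^esub> m)"

text \<open>The element \<open>x\<^sup>*\<close> of the fiber cone: the class of \<open>x\<close> in \<open>xA / xm\<close>, in degree 1.\<close>

definition initial_form :: "('a, 'b) ring_scheme \<Rightarrow> 'a set \<Rightarrow> 'a \<Rightarrow> nat \<Rightarrow> 'a set" where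
  "initial_form A m x =
     (\<lambda>n. if n = 1 then (x <#\<^bsub>A\<^esub> m) +>\<^bsub>A\<^esub> x else (x [^]\<^bsub>A\<^esub> n) <#\<^bsub>A\<^esub> m)"


section \<open>Reductions and the two families of invariants\<close>

definition minimal_reduction :: "('a, 'b) ring_scheme \<Rightarrow> 'a set \<Rightarrow> 'a \<Rightarrow> bool" where
  "minimal_reduction A m x \<longleftrightarrow>
     x \<in> m \<and> (\<exists>n. ideal_pow A m (n + 1) = x <#\<^bsub>A\<^esub> ideal_pow A m n)"

definition reduction_number :: "('a, 'b) ring_scheme \<Rightarrow> 'a set \<Rightarrow> 'a \<Rightarrow> nat" where
  "reduction_number A m x = (LEAST n. ideal_pow A m (n + 1) = x <#\<^bsub>A\<^esub> ideal_pow A m n)"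

text \<open>\<open>\<alpha> i\<close> and \<open>\<beta> i j\<close> are the multiplicities of \<open>F(-i)\<close> and \<open>(F / (x\<^sup>*)\<^sup>j F)(-i)\<close>; the last
  component \<open>k\<close> of an index counts the copies. Only the values of \<open>\<alpha>\<close> and \<open>\<beta>\<close> in the index ranges
  below are constrained.\<close>

definition tangent_cone_invariants ::
    "('a, 'b) ring_scheme \<Rightarrow> 'a set \<Rightarrow> 'a \<Rightarrow> (nat \<Rightarrow> nat) \<Rightarrow> (nat \<Rightarrow> nat \<Rightarrow> nat) \<Rightarrow> bool" where
  "tangent_cone_invariants A m x \<alpha> \<beta> \<longleftrightarrow>
     (let r = reduction_number A m x; F = fiber_cone A m x in
      gmodule_iso F (tangent_cone A m)
        (gdirect_sum2
          (gdirect_sum {(i, k). i \<le> r \<and> k < \<alpha> i} (\<lambda>(i, k). gshift F i))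
          (gdirect_sum {(i, j, k). i \<in> {1..r - 1} \<and> j \<in> {1..r - i} \<and> k < \<beta> i j}
            (\<lambda>(i, j, k). gshift (gquot F (PIdl\<^bsub>F\<^esub> (initial_form A m x [^]\<^bsub>F\<^esub> j))) i))))"

definition apery_invariant :: "('a, 'b) ring_scheme \<Rightarrow> 'a set \<Rightarrow> 'a \<Rightarrow> nat \<Rightarrow> enat" where
  "apery_invariant A m x i = quot_length A
     (ideal_pow A m i <+>\<^bsub>A\<^esub> PIdl\<^bsub>A\<^esub> x) (ideal_pow A m (i + 1) <+>\<^bsub>A\<^esub> PIdl\<^bsub>A\<^esub> x)"

end

theory Submission
  imports Defs
begin

text \<open>
  The left-hand side counts the minimal generators of degree \<open>i\<close> of the tangent cone as a module
  over the fiber cone \<open>K[x\<^sup>*]\<close>, and both terms on the right measure parts of the same space.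

  A free summand \<open>F(-e)\<close> and a torsion summand \<open>(F / (x\<^sup>*)\<^sup>j F)(-e)\<close> are both cyclic with a generator of
  degree \<open>e\<close>, so in degree \<open>i \<ge> 1\<close> everything in them is a multiple of \<open>x\<^sup>*\<close> if \<open>e \<noteq> i\<close>, while
  a one-dimensional space of degree-\<open>i\<close> elements survives modulo \<open>x\<^sup>*\<close> if \<open>e = i\<close>. The
  degree-\<open>i\<close> part of the tangent cone modulo \<open>x\<^sup>*\<close> times the degree-\<open>(i - 1)\<close> part is
  \<open>m\<^sup>i / (x m\<^sup>i\<^sup>-\<^sup>1 + m\<^sup>i\<^sup>+\<^sup>1)\<close>. Hence the length of this module is
  \<open>\<alpha>\<^sub>i + \<Sum>\<^sub>j \<alpha>\<^sub>i\<^sub>,\<^sub>j\<close> with \<open>j\<close> running up to \<open>r - i\<close> (\<open>number_of_generators\<close>).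

  For \<open>i < r\<close> the last multiplicity \<open>\<alpha>\<^sub>i\<^sub>,\<^sub>r\<^sub>-\<^sub>i\<close> vanishes. The module \<open>(F / (x\<^sup>*)\<^sup>r\<^sup>-\<^sup>i F)(-i)\<close> has a nonzero element of
  degree \<open>r - 1\<close> killed by \<open>x\<^sup>*\<close> (\<open>torsion_element\<close>), which would be the class of some
  \<open>b \<in> m\<^sup>r\<^sup>-\<^sup>1 - m\<^sup>r\<close> with \<open>x b \<in> m\<^sup>r\<^sup>+\<^sup>1 = x m\<^sup>r\<close> (\<open>torsion_coordinate\<close>); as \<open>x\<close> is a nonzerodivisor, \<open>b\<close> would lie in \<open>m\<^sup>r\<close>.
  That \<open>x\<close> is a nonzerodivisor comes from depth 1: some \<open>y \<in> m\<close> is one, and a power of \<open>y\<close> is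
  a multiple of \<open>x\<close>.

  On the other side, the ideal \<open>P = (m\<^sup>i \<inter> xA) + m\<^sup>i\<^sup>+\<^sup>1\<close> lies between \<open>x m\<^sup>i\<^sup>-\<^sup>1 + m\<^sup>i\<^sup>+\<^sup>1\<close> and \<open>m\<^sup>i\<close>. By the
  modular law \<open>P = m\<^sup>i \<inter> (m\<^sup>i\<^sup>+\<^sup>1 + xA)\<close>, so \<open>m\<^sup>i / P\<close> is isomorphic to
  \<open>(m\<^sup>i + xA) / (m\<^sup>i\<^sup>+\<^sup>1 + xA)\<close>, whose length is the Apery invariant. Additivity of length gives the
  formula (\<open>apery_plus_intersection\<close>).

  Lengths of quotients \<open>I / J\<close> are computed throughout inside the modular lattice of ideals of
  \<open>A\<close>, as the supremum of the lengths of chains of ideals between \<open>J\<close> and \<open>I\<close>.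
\<close>


section \<open>Length in the lattice of ideals\<close>

definition interval_length :: "('a, 'b) ring_scheme \<Rightarrow> 'a set \<Rightarrow> 'a set \<Rightarrow> enat" where
  "interval_length A J I =
     Sup {enat n | n L. (\<forall>k\<le>n. ideal (L k) A \<and> J \<subseteq> L k \<and> L k \<subseteq> I) \<and> (\<forall>k<n. L k \<subset> L (Suc k))}"

lemma interval_lengthI:
  assumes "\<And>k. k \<le> n \<Longrightarrow> ideal (L k) A \<and> J \<subseteq> L k \<and> L k \<subseteq> I" "\<And>k. k < n \<Longrightarrow> L k \<subset> L (Suc k)"
  shows "enat n \<le> interval_length A J I"
  unfolding interval_length_def by (rule Sup_upper) (use assms in auto)

lemma interval_length_leI:
  assumes "\<And>n L. \<lbrakk>\<And>k. k \<le> n \<Longrightarrow> ideal (L k) A \<and> J \<subseteq> L k \<and> L k \<subseteq> I;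
                   \<And>k. k < n \<Longrightarrow> L k \<subset> L (Suc k)\<rbrakk> \<Longrightarrow> enat n \<le> b"
  shows "interval_length A J I \<le> b"
  unfolding interval_length_def by (rule Sup_least) (use assms in auto)

text \<open>A finite supremum of chain lengths is attained, which is what allows two longest chains to be
  concatenated in the additivity proof.\<close>

lemma Sup_enat_attained:
  assumes "S \<noteq> {}" "Sup S = enat n"
  shows "enat n \<in> S"
proof -
  have "finite S" "Max S = enat n" using assms by (auto simp: Sup_enat_def split: if_splits)
  then show ?thesis using Max_in assms(1) by metis
qed

text \<open>A strictly increasing map between intervals of ideals carries chains to chains. The
  second isomorphism theorem for lengths follows by applying this in both directions.\<close>

lemma interval_length_mono_map:
  assumes "\<And>L. \<lbrakk>ideal L A; J \<subseteq> L; L \<subseteq> I\<rbrakk> \<Longrightarrow> ideal (f L) A \<and> J' \<subseteq> f L \<and> f L \<subseteq> I'"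
    and "\<And>L L'. \<lbrakk>ideal L A; J \<subseteq> L; ideal L' A; L' \<subseteq> I; L \<subset> L'\<rbrakk> \<Longrightarrow> f L \<subset> f L'"
  shows "interval_length A J I \<le> interval_length A J' I'"
proof (rule interval_length_leI)
  fix n L
  assume L: "\<And>k. k \<le> n \<Longrightarrow> ideal (L k) A \<and> J \<subseteq> L k \<and> L k \<subseteq> I" "\<And>k. k < n \<Longrightarrow> L k \<subset> L (Suc k)"
  show "enat n \<le> interval_length A J' I'"
  proof (rule interval_lengthI[where L = "\<lambda>k. f (L k)"])
    show "ideal (f (L k)) A \<and> J' \<subseteq> f (L k) \<and> f (L k) \<subseteq> I'" if "k \<le> n" for k
      using assms(1) L(1)[OF that] by blast
    show "f (L k) \<subset> f (L (Suc k))" if "k < n" for k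
      using assms(2)[of "L k" "L (Suc k)"] L(1)[of k] L(1)[of "Suc k"] L(2)[OF that] that by simp
  qed
qed

context cring
begin

text \<open>Since \<open>ideal_module\<close> keeps the addition of the ring, cosets and coset addition in \<open>I / J\<close> are those of the
  ambient ring.\<close>

lemma quot_module_simps:
  "carrier (quot_module (ideal_module R I) J) = (\<lambda>y. J +> y) ` I"
  "Y \<oplus>\<^bsub>quot_module (ideal_module R I) J\<^esub> Z = Y <+>\<^bsub>R\<^esub> Z"
  "\<zero>\<^bsub>quot_module (ideal_module R I) J\<^esub> = J"
  "a \<odot>\<^bsub>quot_module (ideal_module R I) J\<^esub> Y = (\<Union>y\<in>Y. J +> (a \<otimes> y))"
  by (auto simp: quot_module_def ideal_module_def A_RCOSETS_defs a_r_coset_defs set_add_defs fun_eq_iff)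

lemma coset_eq_iff:
  assumes "ideal J R" "y \<in> carrier R" "z \<in> carrier R"
  shows "J +> y = J +> z \<longleftrightarrow> y \<ominus> z \<in> J"
proof -
  interpret J: ideal J R by fact
  show ?thesis
    by (metis a_coset_add_inv1 a_coset_add_inv2 J.a_rcos_const J.a_subgroup J.a_subset a_coset_join1 a_minus_def minus_closed assms(2,3))
qed

lemma coset_self:
  assumes "ideal J R" "y \<in> carrier R"
  shows "J +> y = J \<longleftrightarrow> y \<in> J"
proof -
  interpret J: ideal J R by fact
  show ?thesis
    by (metis J.a_subgroup a_coset_join1 a_coset_join2 assms(2))
qed

lemma mem_coset_iff:
  assumes "ideal J R" "y \<in> carrier R"
  shows "z \<in> J +> y \<longleftrightarrow> z \<in> carrier R \<and> J +> z = J +> y"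
proof -
  interpret J: ideal J R by fact
  show ?thesis
    by (metis J.a_elemrcos_carrier J.a_rcos_self J.a_repr_independence' J.a_subgroup assms(2))
qed

lemma coset_smult:
  assumes "ideal J R" "y \<in> carrier R" "a \<in> carrier R"
  shows "(\<Union>z\<in>J +> y. J +> (a \<otimes> z)) = J +> (a \<otimes> y)"
proof -
  interpret J: ideal J R by fact
  have "J +> (a \<otimes> z) = J +> (a \<otimes> y)" if "z \<in> J +> y" for z
  proof -
    have z: "z \<in> carrier R" "z \<ominus> y \<in> J" using that assms mem_coset_iff[OF assms(1,2), of z] coset_eq_iff[OF assms(1), of z y] by simp_all
    have "a \<otimes> z \<ominus> a \<otimes> y = a \<otimes> (z \<ominus> y)" using z assms by algebra
    then show ?thesis using coset_eq_iff assms z J.I_l_closed by simp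
  qed
  moreover have "y \<in> J +> y" using assms J.a_rcos_self by blast
  ultimately show ?thesis by blast
qed

lemma group_quot_module:
  assumes "ideal I R" "ideal J R" "J \<subseteq> I"
  shows "group (add_monoid (quot_module (ideal_module R I) J))"
proof -
  interpret I: ideal I R by fact
  interpret J: ideal J R by fact
  have J0: "J = J +> \<zero>" using coset_self[OF assms(2), of \<zero>] by simp
  show ?thesis
  proof (rule groupI, simp_all add: quot_module_simps)
    fix x y assume "x \<in> (+>) J ` I" "y \<in> (+>) J ` I"
    then show "x <+>\<^bsub>R\<^esub> y \<in> (+>) J ` I" by (auto simp: J.a_rcos_sum)
  next
    show "J \<in> (+>) J ` I" using J0 I.zero_closed by blast
  next
    fix x y z assume "x \<in> (+>) J ` I" "y \<in> (+>) J ` I" "z \<in> (+>) J ` I"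
    then show "x <+>\<^bsub>R\<^esub> y <+>\<^bsub>R\<^esub> z = x <+>\<^bsub>R\<^esub> (y <+>\<^bsub>R\<^esub> z)" by (auto simp: J.a_rcos_sum a_assoc)
  next
    fix x assume "x \<in> (+>) J ` I"
    then show "J <+>\<^bsub>R\<^esub> x = x" using J.a_rcos_sum[of \<zero>] J0 by auto
  next
    fix x assume "x \<in> (+>) J ` I"
    then obtain a where "a \<in> I" "x = J +> a" by blast
    then show "\<exists>y\<in>I. (J +> y) <+>\<^bsub>R\<^esub> x = J"
      using J0 by (intro bexI[of _ "\<ominus> a"]) (auto simp: J.a_rcos_sum l_neg)
  qed
qed

text \<open>Together with the converse below, this is the correspondence between ideals in \<open>[J, I]\<close> and
  submodules of \<open>I / J\<close>. The group structure of the quotient serves to identify its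
  inverses, under which a \<open>subgroup\<close> has to be closed.\<close>

lemma submodule_of_ideal:
  assumes "ideal I R" "ideal J R" "ideal L R" "J \<subseteq> L" "L \<subseteq> I"
  shows "submodule ((\<lambda>y. J +> y) ` L) R (quot_module (ideal_module R I) J)"
proof -
  interpret I: ideal I R by fact
  interpret J: ideal J R by fact
  interpret L: ideal L R by fact
  let ?M = "quot_module (ideal_module R I) J"
  have J0: "J = J +> \<zero>" using coset_self[OF assms(2), of \<zero>] by simp
  interpret G: group "add_monoid ?M" using group_quot_module assms by blast
  have inv: "inv\<^bsub>add_monoid ?M\<^esub> (J +> y) = J +> (\<ominus> y)" if "y \<in> L" for y
  proof (rule G.inv_equality)
    have y: "y \<in> carrier R" "y \<in> I" using that assms(5) by auto
    show "(J +> (\<ominus> y)) \<otimes>\<^bsub>add_monoid ?M\<^esub> (J +> y) = \<one>\<^bsub>add_monoid ?M\<^esub>"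
      using y J0 by (simp add: quot_module_simps J.a_rcos_sum l_neg)
    show "J +> y \<in> carrier (add_monoid ?M)" "J +> (\<ominus> y) \<in> carrier (add_monoid ?M)"
      using y by (auto simp: quot_module_simps)
  qed
  show ?thesis
  proof (intro submodule.intro subgroup.intro submodule_axioms.intro)
    show "(+>) J ` L \<subseteq> carrier (add_monoid ?M)" using assms by (auto simp: quot_module_simps)
    show "\<one>\<^bsub>add_monoid ?M\<^esub> \<in> (+>) J ` L" using J0 L.zero_closed by (auto simp: quot_module_simps)
    show "x \<otimes>\<^bsub>add_monoid ?M\<^esub> y \<in> (+>) J ` L" if "x \<in> (+>) J ` L" "y \<in> (+>) J ` L" for x y
      using that by (auto simp: quot_module_simps J.a_rcos_sum)
    show "inv\<^bsub>add_monoid ?M\<^esub> x \<in> (+>) J ` L" if "x \<in> (+>) J ` L" for x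
      using that inv by auto
    show "a \<odot>\<^bsub>?M\<^esub> x \<in> (+>) J ` L" if "a \<in> carrier R" "x \<in> (+>) J ` L" for a x
      using that by (auto simp: quot_module_simps coset_smult[OF assms(2)] L.I_l_closed)
  qed
qed

lemma ideal_of_submodule:
  assumes "ideal I R" "ideal J R" "J \<subseteq> I" "submodule N R (quot_module (ideal_module R I) J)"
  shows "ideal (\<Union>N) R" "J \<subseteq> \<Union>N" "\<Union>N \<subseteq> I" "N = (\<lambda>y. J +> y) ` \<Union>N"
proof -
  interpret I: ideal I R by fact
  interpret J: ideal J R by fact
  let ?M = "quot_module (ideal_module R I) J"
  have sub: "N \<subseteq> (\<lambda>y. J +> y) ` I" using subgroup.subset[OF submodule.axioms(1)[OF assms(4)]] by (simp add: quot_module_simps)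
  have JN: "J \<in> N" using subgroup.one_closed[OF submodule.axioms(1)[OF assms(4)]] by (simp add: quot_module_simps)
  have cos: "y \<in> I \<and> J +> y \<in> N" if yN: "y \<in> \<Union>N" for y
  proof -
    obtain Y where Y: "Y \<in> N" "y \<in> Y" using yN by blast
    have "Y \<in> (\<lambda>y. J +> y) ` I" using sub Y(1) by (rule subsetD)
    then obtain z where "z \<in> I" "Y = J +> z" by (rule imageE)
    then have z: "z \<in> I" "J +> z \<in> N" "y \<in> J +> z" using Y by simp_all
    have zc: "z \<in> carrier R" using z(1) I.Icarr by blast
    have y: "y \<in> carrier R" "J +> y = J +> z" "y \<ominus> z \<in> J"
      using mem_coset_iff[OF assms(2) zc, of y] coset_eq_iff[OF assms(2) _ zc, of y] z(3) by simp_all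
    have "y = (y \<ominus> z) \<oplus> z" using y(1) zc by (simp add: a_minus_def a_assoc l_neg)
    moreover have "(y \<ominus> z) \<oplus> z \<in> I" using y(3) z(1) assms(3) by blast
    ultimately show ?thesis using z y by simp
  qed
  have mem: "y \<in> \<Union>N" if "y \<in> carrier R" "J +> y \<in> N" for y
    using that J.a_rcos_self by blast
  show eq: "N = (\<lambda>y. J +> y) ` \<Union>N"
  proof
    show "N \<subseteq> (\<lambda>y. J +> y) ` \<Union>N"
    proof
      fix Y assume Y: "Y \<in> N"
      then have "Y \<in> (\<lambda>y. J +> y) ` I" using sub by (rule rev_subsetD)
      then obtain z where z: "z \<in> I" "Y = J +> z" by auto
      then show "Y \<in> (\<lambda>y. J +> y) ` \<Union>N" using mem[of z] Y I.Icarr by simp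
    qed
    show "(\<lambda>y. J +> y) ` \<Union>N \<subseteq> N" using cos by (auto simp del: Union_iff)
  qed
  show "J \<subseteq> \<Union>N" using JN by blast
  show "\<Union>N \<subseteq> I" using cos by blast
  have smult: "a \<otimes> y \<in> \<Union>N" if "a \<in> carrier R" "y \<in> \<Union>N" for a y
    using submodule.smult_closed[OF assms(4) that(1) conjunct2[OF cos[OF that(2)]]] cos[OF that(2)] that
    by (intro mem) (auto simp: quot_module_simps coset_smult[OF assms(2)])
  have add: "y \<oplus> z \<in> \<Union>N" if "y \<in> \<Union>N" "z \<in> \<Union>N" for y z
    using subgroup.m_closed[OF submodule.axioms(1)[OF assms(4)] conjunct2[OF cos[OF that(1)]] conjunct2[OF cos[OF that(2)]]] cos[OF that(1)] cos[OF that(2)]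
    by (intro mem) (auto simp: quot_module_simps J.a_rcos_sum)
  have "\<ominus> y \<in> \<Union>N" if "y \<in> \<Union>N" for y
  proof -
    have "y \<in> carrier R" using cos[OF that] I.Icarr by simp
    then have "\<ominus> y = (\<ominus> \<one>) \<otimes> y" by (simp add: l_minus)
    then show ?thesis using smult[of "\<ominus> \<one>" y] that by simp
  qed
  moreover have "\<zero> \<in> \<Union>N" using JN J.zero_closed by blast
  moreover have "\<Union>N \<subseteq> carrier R" using cos I.Icarr by (meson subsetI)
  ultimately have "subgroup (\<Union>N) (add_monoid R)"
    by (intro add.subgroupI) (use add in auto)
  then show "ideal (\<Union>N) R"
  proof (rule idealI[OF ring_axioms])
    fix a y assume "a \<in> \<Union>N" "y \<in> carrier R"
    then show "y \<otimes> a \<in> \<Union>N" "a \<otimes> y \<in> \<Union>N" using smult[of y a] cos[of a] I.Icarr[of a] m_comm[of a y] by simp_all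
  qed
qed

lemma quot_length_eq_interval_length:
  assumes "ideal I R" "ideal J R" "J \<subseteq> I"
  shows "quot_length R I J = interval_length R J I"
proof (rule antisym)
  show "interval_length R J I \<le> quot_length R I J"
  proof (rule interval_length_leI)
    fix n L assume L: "\<And>k. k \<le> n \<Longrightarrow> ideal (L k) R \<and> J \<subseteq> L k \<and> L k \<subseteq> I"
      "\<And>k. k < n \<Longrightarrow> L k \<subset> L (Suc k)"
    let ?N = "\<lambda>k. (\<lambda>y. J +> y) ` L k"
    have "?N k \<subset> ?N (Suc k)" if k: "k < n" for k
    proof -
      obtain y where y: "y \<in> L (Suc k)" "y \<notin> L k" using L(2)[OF k] by blast
      interpret Lk: ideal "L k" R using L(1) k by simp
      interpret Lk': ideal "L (Suc k)" R using L(1) k by simp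
      have "J +> y \<notin> ?N k"
      proof
        assume "J +> y \<in> ?N k"
        then obtain z where z: "z \<in> L k" "J +> y = J +> z" by blast
        then have "y \<ominus> z \<in> L k" using coset_eq_iff[OF assms(2)] y L(1)[of k] k by auto
        moreover have "y = (y \<ominus> z) \<oplus> z" using y(1) z(1) Lk.Icarr Lk'.Icarr by algebra
        ultimately show False using z y(2) by (metis Lk.a_closed)
      qed
      then show ?thesis using y L(2)[OF k] by blast
    qed
    moreover have "submodule (?N k) R (quot_module (ideal_module R I) J)" if "k \<le> n" for k
      using submodule_of_ideal[OF assms(1,2)] L(1)[OF that] by simp
    ultimately show "enat n \<le> quot_length R I J" unfolding quot_length_def module_length_def
      by (intro Sup_upper CollectI exI[of _ n] exI[of _ ?N] conjI refl allI impI)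
  qed
  show "quot_length R I J \<le> interval_length R J I"
    unfolding quot_length_def module_length_def
  proof (rule Sup_least)
    fix z assume "z \<in> {enat n | n N. (\<forall>i\<le>n. submodule (N i) R (quot_module (ideal_module R I) J)) \<and> (\<forall>i<n. N i \<subset> N (Suc i))}"
    then obtain n N where z: "z = enat n"
      and N: "\<And>i. i \<le> n \<Longrightarrow> submodule (N i) R (quot_module (ideal_module R I) J)"
        "\<And>i. i < n \<Longrightarrow> N i \<subset> N (Suc i)" by auto
    note union = ideal_of_submodule[OF assms N(1)]
    show "z \<le> interval_length R J I" unfolding z
    proof (rule interval_lengthI[where L = "\<lambda>k. \<Union>(N k)"])
      show "ideal (\<Union> (N k)) R \<and> J \<subseteq> \<Union> (N k) \<and> \<Union> (N k) \<subseteq> I" if "k \<le> n" for k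
        using union(1-3)[OF that] by simp
      show "\<Union> (N k) \<subset> \<Union> (N (Suc k))" if k: "k < n" for k
      proof (rule psubsetI)
        show "\<Union> (N k) \<subseteq> \<Union> (N (Suc k))" using N(2)[OF k] by (intro Union_mono) simp
        have "N k = (\<lambda>y. J +> y) ` \<Union>(N k)" "N (Suc k) = (\<lambda>y. J +> y) ` \<Union>(N (Suc k))"
          using union(4)[of k] union(4)[of "Suc k"] k by simp_all
        then show "\<Union> (N k) \<noteq> \<Union> (N (Suc k))" using N(2)[OF k] by (metis less_irrefl)
      qed
    qed
  qed
qed

lemma interval_length_attained:
  assumes "ideal J R" "J \<subseteq> I" "interval_length R J I = enat n"
  shows "\<exists>L. (\<forall>k\<le>n. ideal (L k) R \<and> J \<subseteq> L k \<and> L k \<subseteq> I) \<and> (\<forall>k<n. L k \<subset> L (Suc k))"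
proof -
  let ?S = "{enat n | n L. (\<forall>k\<le>n. ideal (L k) R \<and> J \<subseteq> L k \<and> L k \<subseteq> I) \<and> (\<forall>k<n. L k \<subset> L (Suc k))}"
  have "enat 0 \<in> ?S"
    by (rule CollectI, rule exI[of _ 0], rule exI[of _ "\<lambda>_. J"]) (use assms in simp)
  then have "?S \<noteq> {}" by blast
  moreover have "Sup ?S = enat n" using assms(3) unfolding interval_length_def .
  ultimately have "enat n \<in> ?S" by (rule Sup_enat_attained)
  then show ?thesis by auto
qed

text \<open>Chains with repetitions arise by intersecting a strict chain with a fixed ideal, or adding a
  fixed ideal to it. Their strict steps still bound the length from below.\<close>

lemma interval_length_weak_chain:
  assumes "\<And>k. k \<le> n \<Longrightarrow> ideal (L k) R \<and> J \<subseteq> L k \<and> L k \<subseteq> I" "\<And>k. k < n \<Longrightarrow> L k \<subseteq> L (Suc k)"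
  shows "enat (card {k. k < n \<and> L k \<noteq> L (Suc k)}) \<le> interval_length R J I"
proof -
  let ?c = "\<lambda>n. card {k. k < n \<and> L k \<noteq> L (Suc k)}"
  have "\<exists>L'. (\<forall>k\<le>?c n. ideal (L' k) R \<and> J \<subseteq> L' k \<and> L' k \<subseteq> I) \<and> (\<forall>k<?c n. L' k \<subset> L' (Suc k)) \<and> L' (?c n) = L n"
    using assms
  proof (induction n)
    case 0
    then show ?case by (intro exI[of _ L]) simp
  next
    case (Suc n)
    have "\<exists>L'. (\<forall>k\<le>?c n. ideal (L' k) R \<and> J \<subseteq> L' k \<and> L' k \<subseteq> I) \<and> (\<forall>k<?c n. L' k \<subset> L' (Suc k)) \<and> L' (?c n) = L n"
      by (rule Suc.IH) (use Suc.prems in \<open>simp_all\<close>)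
    then obtain L' where L': "\<And>k. k \<le> ?c n \<Longrightarrow> ideal (L' k) R \<and> J \<subseteq> L' k \<and> L' k \<subseteq> I"
      "\<And>k. k < ?c n \<Longrightarrow> L' k \<subset> L' (Suc k)" "L' (?c n) = L n" by auto
    show ?case
    proof (cases "L n = L (Suc n)")
      case True
      then have "{k. k < Suc n \<and> L k \<noteq> L (Suc k)} = {k. k < n \<and> L k \<noteq> L (Suc k)}"
        using less_Suc_eq by auto
      then show ?thesis using L' True by (intro exI[of _ L']) simp
    next
      case False
      then have "{k. k < Suc n \<and> L k \<noteq> L (Suc k)} = insert n {k. k < n \<and> L k \<noteq> L (Suc k)}"
        using less_Suc_eq by auto
      then have c: "?c (Suc n) = Suc (?c n)" by simp
      have "L n \<subset> L (Suc n)" using False Suc.prems(2)[of n] by blast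
      then show ?thesis unfolding c using L' Suc.prems(1)[of "Suc n"]
        by (intro exI[of _ "L'(Suc (?c n) := L (Suc n))"]) (auto simp: le_Suc_eq less_Suc_eq)
    qed
  qed
  then obtain L' where "\<And>k. k \<le> ?c n \<Longrightarrow> ideal (L' k) R \<and> J \<subseteq> L' k \<and> L' k \<subseteq> I"
      "\<And>k. k < ?c n \<Longrightarrow> L' k \<subset> L' (Suc k)" by auto
  then show ?thesis by (rule interval_lengthI)
qed

lemma ideal_subset: "ideal L R \<Longrightarrow> L \<subseteq> carrier R"
  by (simp add: additive_subgroup.a_subset ideal.axioms(1))

lemma ideal_diff_closed:
  assumes "ideal L R" "y \<in> L" "z \<in> L"
  shows "y \<ominus> z \<in> L"
  unfolding a_minus_def using assms(2) additive_subgroup.a_inv_closed[OF ideal.axioms(1)[OF assms(1)] assms(3)]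
  by (rule additive_subgroup.a_closed[OF ideal.axioms(1)[OF assms(1)]])

lemma set_addE:
  assumes "y \<in> B <+>\<^bsub>R\<^esub> C"
  obtains b c where "b \<in> B" "c \<in> C" "y = b \<oplus> c"
  using assms by (auto simp: set_add_def')

lemma set_add_upper:
  assumes "ideal B R" "ideal C R"
  shows "B \<subseteq> B <+>\<^bsub>R\<^esub> C" "C \<subseteq> B <+>\<^bsub>R\<^esub> C"
proof -
  interpret B: ideal B R by fact
  interpret C: ideal C R by fact
  show "B \<subseteq> B <+>\<^bsub>R\<^esub> C"
  proof
    fix b assume b: "b \<in> B"
    then have "b = b \<oplus> \<zero>" using B.Icarr by simp
    then show "b \<in> B <+>\<^bsub>R\<^esub> C" using b C.zero_closed unfolding set_add_def' by blast
  qed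
  show "C \<subseteq> B <+>\<^bsub>R\<^esub> C"
  proof
    fix b assume b: "b \<in> C"
    then have "b = \<zero> \<oplus> b" using C.Icarr by simp
    then show "b \<in> B <+>\<^bsub>R\<^esub> C" using b B.zero_closed unfolding set_add_def' by blast
  qed
qed

lemma set_add_least:
  assumes "ideal D R" "B \<subseteq> D" "C \<subseteq> D"
  shows "B <+>\<^bsub>R\<^esub> C \<subseteq> D"
proof
  fix y assume "y \<in> B <+>\<^bsub>R\<^esub> C"
  then obtain b c where "b \<in> B" "c \<in> C" "y = b \<oplus> c" by (rule set_addE)
  then show "y \<in> D" using assms additive_subgroup.a_closed[OF ideal.axioms(1)[OF assms(1)]] by blast
qed

text \<open>The cancellation form of the modular law: nested ideals \<open>L \<subseteq> L'\<close> agree as soon as they have the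
  same intersection with \<open>P\<close> and the same sum with \<open>P\<close>.\<close>

lemma mem_of_set_add:
  assumes "ideal L' R" "ideal L R" "L \<subseteq> L'" "y \<in> L'" "y \<in> L <+>\<^bsub>R\<^esub> P" "P \<subseteq> carrier R" "L' \<inter> P \<subseteq> L"
  shows "y \<in> L"
proof -
  obtain l p where lp: "l \<in> L" "p \<in> P" "y = l \<oplus> p" using assms(5) by (rule set_addE)
  then have "l \<in> carrier R" "p \<in> carrier R" using ideal_subset[OF assms(2)] assms(6) by auto
  then have "y \<ominus> l = p" unfolding lp(3) by algebra
  moreover have "y \<ominus> l \<in> L'" by (rule ideal_diff_closed) (use assms lp in auto)
  ultimately have "p \<in> L" using lp assms(7) by blast
  then show ?thesis using lp additive_subgroup.a_closed[OF ideal.axioms(1)[OF assms(2)]] by simp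
qed

text \<open>For \<open>\<le>\<close>, a chain in \<open>[J, I]\<close> is intersected with \<open>P\<close> and added to \<open>P\<close>. By modularity every strict
  step survives in at least one of the two resulting weak chains. For \<open>\<ge>\<close>, chains below and above
  \<open>P\<close> are concatenated.\<close>

lemma interval_length_add:
  assumes "ideal J R" "ideal P R" "ideal I R" "J \<subseteq> P" "P \<subseteq> I"
  shows "interval_length R J I = interval_length R J P + interval_length R P I"
proof (rule antisym)
  have Pc: "P \<subseteq> carrier R" using assms(2) by (rule ideal_subset)
  show "interval_length R J I \<le> interval_length R J P + interval_length R P I"
  proof (rule interval_length_leI)
    fix n L assume L: "\<And>k. k \<le> n \<Longrightarrow> ideal (L k) R \<and> J \<subseteq> L k \<and> L k \<subseteq> I"
      "\<And>k. k < n \<Longrightarrow> L k \<subset> L (Suc k)"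
    let ?a = "\<lambda>k. L k \<inter> P" and ?b = "\<lambda>k. L k <+>\<^bsub>R\<^esub> P"
    let ?A = "{k. k < n \<and> ?a k \<noteq> ?a (Suc k)}" and ?B = "{k. k < n \<and> ?b k \<noteq> ?b (Suc k)}"
    have "\<not> (?a k = ?a (Suc k) \<and> ?b k = ?b (Suc k))" if k: "k < n" for k
    proof
      assume eq: "?a k = ?a (Suc k) \<and> ?b k = ?b (Suc k)"
      have Lk: "ideal (L k) R" "ideal (L (Suc k)) R" using L(1) k by auto
      have "y \<in> L k" if y: "y \<in> L (Suc k)" for y
      proof (rule mem_of_set_add[of "L (Suc k)" _ _ P])
        show "y \<in> L k <+>\<^bsub>R\<^esub> P" using set_add_upper(1)[OF Lk(2) assms(2)] y eq by blast
      qed (use Lk L(2)[OF k] Pc y eq in auto)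
      then show False using L(2)[OF k] by blast
    qed
    then have "{..<n} \<subseteq> ?A \<union> ?B" by auto
    then have "n \<le> card (?A \<union> ?B)" using card_mono[of "?A \<union> ?B" "{..<n}"] by simp
    then have n: "enat n \<le> enat (card ?A) + enat (card ?B)" using card_Un_le[of ?A ?B] by simp
    have "enat (card ?A) \<le> interval_length R J P"
    proof (rule interval_length_weak_chain)
      show "ideal (L k \<inter> P) R \<and> J \<subseteq> L k \<inter> P \<and> L k \<inter> P \<subseteq> P" if "k \<le> n" for k
        using L(1)[OF that] assms i_intersect by simp
      show "L k \<inter> P \<subseteq> L (Suc k) \<inter> P" if "k < n" for k using L(2)[OF that] by blast
    qed
    moreover have "enat (card ?B) \<le> interval_length R P I"
    proof (rule interval_length_weak_chain)
      show "ideal (L k <+>\<^bsub>R\<^esub> P) R \<and> P \<subseteq> L k <+>\<^bsub>R\<^esub> P \<and> L k <+>\<^bsub>R\<^esub> P \<subseteq> I" if "k \<le> n" for k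
        using L(1)[OF that] assms add_ideals set_add_upper set_add_least by simp
      show "L k <+>\<^bsub>R\<^esub> P \<subseteq> L (Suc k) <+>\<^bsub>R\<^esub> P" if "k < n" for k
        using L(2)[OF that] by (auto simp: set_add_def')
    qed
    ultimately show "enat n \<le> interval_length R J P + interval_length R P I"
      using n by (meson add_mono order_trans)
  qed
  show "interval_length R J P + interval_length R P I \<le> interval_length R J I"
  proof (cases "interval_length R J I")
    case (enat N)
    have "interval_length R J P \<le> enat N" unfolding enat[symmetric]
      by (rule interval_length_mono_map[where f = "\<lambda>x. x"]) (use assms in auto)
    moreover have "interval_length R P I \<le> enat N" unfolding enat[symmetric]
      by (rule interval_length_mono_map[where f = "\<lambda>x. x"]) (use assms in auto)
    ultimately obtain p q where pq: "interval_length R J P = enat p" "interval_length R P I = enat q"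
      by (metis enat_ile)
    obtain L where L: "\<And>k. k \<le> p \<Longrightarrow> ideal (L k) R \<and> J \<subseteq> L k \<and> L k \<subseteq> P" "\<And>k. k < p \<Longrightarrow> L k \<subset> L (Suc k)"
      using interval_length_attained[OF assms(1,4) pq(1)] by auto
    obtain M where M: "\<And>k. k \<le> q \<Longrightarrow> ideal (M k) R \<and> P \<subseteq> M k \<and> M k \<subseteq> I" "\<And>k. k < q \<Longrightarrow> M k \<subset> M (Suc k)"
      using interval_length_attained[OF assms(2,5) pq(2)] by auto
    let ?N = "\<lambda>k. if k \<le> p then L k else M (k - p)"
    have "enat (p + q) \<le> interval_length R J I"
    proof (rule interval_lengthI)
      show "ideal (?N k) R \<and> J \<subseteq> ?N k \<and> ?N k \<subseteq> I" if "k \<le> p + q" for k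
        using L(1)[of k] M(1)[of "k - p"] that order_trans[OF _ assms(5), of "L k"]
          order_trans[OF assms(4), of "M (k - p)"]
        by (cases "k \<le> p") simp_all
      show "?N k \<subset> ?N (Suc k)" if k: "k < p + q" for k
      proof -
        consider "k < p" | "k = p" | "k > p" by linarith
        then show ?thesis
        proof cases
          case 1
          then show ?thesis using L(2)[of k] by simp
        next
          case 2
          then have "L p \<subseteq> M 0" "M 0 \<subset> M 1" using L(1)[of p] M(1)[of 0] M(2)[of 0] k by auto
          then show ?thesis using 2 by auto
        next
          case 3
          then show ?thesis using M(2)[of "k - p"] k by (simp add: Suc_diff_le)
        qed
      qed
    qed
    then show ?thesis using pq by simp
  qed simp
qed

text \<open>The length form of \<open>(B + C) / B \<cong> C / (B \<inter> C)\<close>: the intervals are transposes of each other in a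
  modular lattice.\<close>

lemma interval_length_sum:
  assumes B: "ideal B R" and C: "ideal C R"
  shows "interval_length R B (B <+>\<^bsub>R\<^esub> C) = interval_length R (B \<inter> C) C"
proof (rule antisym)
  have sub: "B \<subseteq> carrier R" "C \<subseteq> carrier R" using B C ideal_subset by simp_all
  show "interval_length R B (B <+>\<^bsub>R\<^esub> C) \<le> interval_length R (B \<inter> C) C"
  proof (rule interval_length_mono_map[where f = "\<lambda>L. L \<inter> C"])
    fix L L' assume L: "ideal L R" "B \<subseteq> L" "ideal L' R" "L' \<subseteq> B <+>\<^bsub>R\<^esub> C" "L \<subset> L'"
    have "\<not> L' \<inter> C \<subseteq> L \<inter> C"
    proof
      assume eq: "L' \<inter> C \<subseteq> L \<inter> C"
      have "y \<in> L" if y: "y \<in> L'" for y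
      proof (rule mem_of_set_add[of L' _ _ C])
        show "y \<in> L <+>\<^bsub>R\<^esub> C" using y L(2,4) unfolding set_add_def' by blast
      qed (use L eq y sub in auto)
      then show False using L(5) by blast
    qed
    then show "L \<inter> C \<subset> L' \<inter> C" using L(5) by blast
  qed (use C in \<open>auto intro: i_intersect\<close>)
  show "interval_length R (B \<inter> C) C \<le> interval_length R B (B <+>\<^bsub>R\<^esub> C)"
  proof (rule interval_length_mono_map[where f = "\<lambda>L. L <+>\<^bsub>R\<^esub> B"])
    fix L assume L: "ideal L R" "B \<inter> C \<subseteq> L" "L \<subseteq> C"
    have "C \<subseteq> B <+>\<^bsub>R\<^esub> C" "B \<subseteq> B <+>\<^bsub>R\<^esub> C" using set_add_upper[OF B C] by simp_all
    then show "ideal (L <+>\<^bsub>R\<^esub> B) R \<and> B \<subseteq> L <+>\<^bsub>R\<^esub> B \<and> L <+>\<^bsub>R\<^esub> B \<subseteq> B <+>\<^bsub>R\<^esub> C"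
      using L B C add_ideals set_add_upper(2)[OF L(1) B] set_add_least[of "B <+>\<^bsub>R\<^esub> C" L B] by auto
  next
    fix L L' assume L: "ideal L R" "B \<inter> C \<subseteq> L" "ideal L' R" "L' \<subseteq> C" "L \<subset> L'"
    have "\<not> L' <+>\<^bsub>R\<^esub> B \<subseteq> L <+>\<^bsub>R\<^esub> B"
    proof
      assume eq: "L' <+>\<^bsub>R\<^esub> B \<subseteq> L <+>\<^bsub>R\<^esub> B"
      have "y \<in> L" if y: "y \<in> L'" for y
      proof (rule mem_of_set_add[of L' _ _ B])
        show "y \<in> L <+>\<^bsub>R\<^esub> B" using set_add_upper(1)[OF L(3) B] y eq by blast
      qed (use L y sub in auto)
      then show False using L(5) by blast
    qed
    moreover have "L <+>\<^bsub>R\<^esub> B \<subseteq> L' <+>\<^bsub>R\<^esub> B" using L(5) by (auto simp: set_add_def')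
    ultimately show "L <+>\<^bsub>R\<^esub> B \<subset> L' <+>\<^bsub>R\<^esub> B" by blast
  qed
qed

text \<open>Here \<open>I / J\<close> is a one-dimensional vector space over \<open>R / m\<close>. An ideal strictly above \<open>J\<close> contains
  some \<open>c e\<close> with \<open>c \<notin> m\<close> modulo \<open>J\<close>, and \<open>c\<close> is invertible modulo \<open>m\<close>.\<close>

lemma interval_length_eq_1:
  assumes m: "maximalideal m R" and J: "ideal J R" and I: "ideal I R" and "J \<subseteq> I"
    and e: "e \<in> I" "e \<notin> J" and me: "\<And>c. c \<in> m \<Longrightarrow> c \<otimes> e \<in> J"
    and gen: "\<And>a. a \<in> I \<Longrightarrow> \<exists>c\<in>carrier R. a \<ominus> c \<otimes> e \<in> J"
  shows "interval_length R J I = 1"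
proof (rule antisym)
  interpret m: maximalideal m R by fact
  interpret J: ideal J R by fact
  interpret I: ideal I R by fact
  have "enat 1 \<le> interval_length R J I"
    by (rule interval_lengthI[where L = "\<lambda>k. if k = 0 then J else I"]) (use assms in auto)
  then show "1 \<le> interval_length R J I" by (simp add: one_enat_def)
  have simple: "L = J \<or> L = I" if L: "ideal L R" "J \<subseteq> L" "L \<subseteq> I" for L
  proof (rule disjCI)
    interpret L: ideal L R by fact
    assume "L \<noteq> I"
    have "y \<in> J" if y: "y \<in> L" for y
    proof -
      obtain c where c: "c \<in> carrier R" "y \<ominus> c \<otimes> e \<in> J" using gen y L(3) by blast
      have carr: "y \<in> carrier R" "e \<in> carrier R" using y e by simp_all
      have ce: "c \<otimes> e = y \<ominus> (y \<ominus> c \<otimes> e)" using carr c(1) by algebra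
      have "c \<in> m"
      proof (rule ccontr)
        assume "c \<notin> m"
        have "ideal (m <+>\<^bsub>R\<^esub> PIdl c) R"
          using add_ideals[OF m.ideal_axioms cgenideal_ideal[OF c(1)]] .
        moreover have "c \<in> m <+>\<^bsub>R\<^esub> PIdl c" "m \<subseteq> m <+>\<^bsub>R\<^esub> PIdl c"
          using set_add_upper[OF m.ideal_axioms cgenideal_ideal[OF c(1)]] cgenideal_self[OF c(1)] by blast+
        ultimately have "m <+>\<^bsub>R\<^esub> PIdl c = carrier R"
          using m.I_maximal[of "m <+>\<^bsub>R\<^esub> PIdl c"] \<open>c \<notin> m\<close> ideal_subset[of "m <+>\<^bsub>R\<^esub> PIdl c"] by blast
        then have "\<one> \<in> m <+>\<^bsub>R\<^esub> PIdl c" by simp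
        then obtain u v where uv: "u \<in> m" "v \<in> PIdl c" "\<one> = u \<oplus> v" by (rule set_addE)
        then obtain d where d: "d \<in> carrier R" "v = d \<otimes> c" unfolding cgenideal_def by blast
        have uc: "u \<in> carrier R" using uv by simp
        have "e = \<one> \<otimes> e" using carr by simp
        also have "\<dots> = u \<otimes> e \<oplus> d \<otimes> (c \<otimes> e)" unfolding uv(3) d(2) using uc d(1) c(1) carr by algebra
        finally have ee: "e = u \<otimes> e \<oplus> d \<otimes> (c \<otimes> e)" .
        have "c \<otimes> e \<in> L" using ce y c(2) L ideal_diff_closed by (metis subsetD)
        then have "d \<otimes> (c \<otimes> e) \<in> L" using d(1) by (rule L.I_l_closed)
        moreover have "u \<otimes> e \<in> L" using me[OF uv(1)] L(2) by blast
        ultimately have eL: "e \<in> L" using ee L.a_closed by metis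
        have "a \<in> L" if a: "a \<in> I" for a
        proof -
          obtain b where b: "b \<in> carrier R" "a \<ominus> b \<otimes> e \<in> J" using gen a by blast
          have "a = (a \<ominus> b \<otimes> e) \<oplus> b \<otimes> e" using I.Icarr[OF a] b(1) carr by algebra
          moreover have "b \<otimes> e \<in> L" using eL b(1) by (rule L.I_l_closed)
          moreover have "a \<ominus> b \<otimes> e \<in> L" using b(2) L(2) by blast
          ultimately show ?thesis using L.a_closed by metis
        qed
        then show False using L(3) \<open>L \<noteq> I\<close> by blast
      qed
      then have "c \<otimes> e \<in> J" by (rule me)
      moreover have "y = (y \<ominus> c \<otimes> e) \<oplus> c \<otimes> e" using carr c(1) by algebra
      ultimately show ?thesis using c(2) J.a_closed by metis
    qed
    then show "L = J" using L(2) by blast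
  qed
  show "interval_length R J I \<le> 1"
  proof (rule interval_length_leI)
    fix n L assume L: "\<And>k. k \<le> n \<Longrightarrow> ideal (L k) R \<and> J \<subseteq> L k \<and> L k \<subseteq> I"
      "\<And>k. k < n \<Longrightarrow> L k \<subset> L (Suc k)"
    have "n \<le> 1"
    proof (rule ccontr)
      assume "\<not> n \<le> 1"
      then have "L 0 \<subset> L 1" "L 1 \<subset> L 2" "J \<subseteq> L 0" "L 2 \<subseteq> I" "ideal (L 1) R" "J \<subseteq> L 1" "L 1 \<subseteq> I"
        using L(1)[of 0] L(1)[of 1] L(1)[of 2] L(2)[of 0] L(2)[of 1] by (simp_all add: numeral_2_eq_2)
      then show False using simple[of "L 1"] by blast
    qed
    then show "enat n \<le> 1" by (simp add: one_enat_def)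
  qed
qed

text \<open>Dimension counting with a dual basis: \<open>H s\<close> is the kernel of the coordinate \<open>s\<close> on \<open>I\<close>, and \<open>e s\<close> is the
  basis vector of that coordinate. Intersecting with the kernels one at a time lowers the dimension
  over \<open>R / m\<close> by one each time.\<close>

lemma interval_length_coordinates:
  assumes m: "maximalideal m R" and "finite S" and I: "ideal I R"
    and H: "\<And>s. s \<in> S \<Longrightarrow> ideal (H s) R"
    and e: "\<And>s. s \<in> S \<Longrightarrow> e s \<in> I" "\<And>s. s \<in> S \<Longrightarrow> e s \<notin> H s"
      "\<And>s t. s \<in> S \<Longrightarrow> t \<in> S \<Longrightarrow> s \<noteq> t \<Longrightarrow> e s \<in> H t"
    and me: "\<And>s c. s \<in> S \<Longrightarrow> c \<in> m \<Longrightarrow> c \<otimes> e s \<in> H s"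
    and gen: "\<And>s a. s \<in> S \<Longrightarrow> a \<in> I \<Longrightarrow> \<exists>c\<in>carrier R. a \<ominus> c \<otimes> e s \<in> H s"
  shows "ideal (I \<inter> (\<Inter>s\<in>S. H s)) R \<and> interval_length R (I \<inter> (\<Inter>s\<in>S. H s)) I = enat (card S)"
  using assms(2) H e me gen
proof (induction S)
  case empty
  have "interval_length R I I \<le> 0"
  proof (rule interval_length_leI)
    fix n L assume L: "\<And>k. k \<le> n \<Longrightarrow> ideal (L k) R \<and> I \<subseteq> L k \<and> L k \<subseteq> I"
      "\<And>k. k < n \<Longrightarrow> L k \<subset> L (Suc k)"
    show "enat n \<le> 0"
    proof (cases n)
      case (Suc k)
      then show ?thesis using L(1)[of 0] L(1)[of 1] L(2)[of 0] by auto
    qed (simp add: zero_enat_def)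
  qed
  then have "interval_length R I I = 0" by simp
  then show ?case using I by (simp add: zero_enat_def)
next
  case (insert s S)
  let ?I = "I \<inter> (\<Inter>s\<in>S. H s)" and ?J = "I \<inter> (\<Inter>s\<in>insert s S. H s)"
  have IH: "ideal ?I R \<and> interval_length R ?I I = enat (card S)"
    by (rule insert.IH) (use insert.prems in \<open>simp_all\<close>)
  have J: "?J = ?I \<inter> H s" by blast
  have idJ: "ideal ?J R" unfolding J by (rule i_intersect) (use IH insert.prems(1) in simp_all)
  have mc: "m \<subseteq> carrier R" using maximalideal.axioms(1)[OF m] by (rule ideal_subset)
  have es: "e s \<in> ?I" using insert.prems(2,4) insert.hyps(2) by auto
  have "interval_length R ?J ?I = 1"
  proof (rule interval_length_eq_1[OF m idJ, where e = "e s"])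
    show "ideal ?I R" using IH by simp
    show "?J \<subseteq> ?I" by blast
    show "e s \<in> ?I" by (rule es)
    show "e s \<notin> ?J" using insert.prems(3) by simp
    show "c \<otimes> e s \<in> ?J" if "c \<in> m" for c
      unfolding J using insert.prems(5)[OF _ that, of s] ideal.I_l_closed[OF conjunct1[OF IH] es, of c] mc that by blast
    show "\<exists>c\<in>carrier R. a \<ominus> c \<otimes> e s \<in> ?J" if a: "a \<in> ?I" for a
    proof -
      obtain c where c: "c \<in> carrier R" "a \<ominus> c \<otimes> e s \<in> H s" using insert.prems(6)[of s a] a by auto
      have "c \<otimes> e s \<in> ?I" using ideal.I_l_closed[OF conjunct1[OF IH] es c(1)] .
      then have "a \<ominus> c \<otimes> e s \<in> ?I" using ideal_diff_closed[OF conjunct1[OF IH] a] by blast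
      then show ?thesis unfolding J using c by blast
    qed
  qed
  moreover have "interval_length R ?J I = interval_length R ?J ?I + interval_length R ?I I"
    by (rule interval_length_add) (use idJ IH I in auto)
  ultimately show ?case using idJ IH insert.hyps by (simp add: one_enat_def)
qed

end

section \<open>Graded rings of cosets\<close>

text \<open>As \<open>Q k\<close> is the zero coset in degree \<open>k\<close>, this is a homogeneous element of the graded ring.\<close>

definition homog :: "('a, 'b) ring_scheme \<Rightarrow> (nat \<Rightarrow> 'a set) \<Rightarrow> nat \<Rightarrow> 'a \<Rightarrow> nat \<Rightarrow> 'a set" where
  "homog A Q n a = Q(n := Q n +>\<^bsub>A\<^esub> a)"

lemma graded_ring_of_simps:
  "carrier (graded_ring_of A P Q) = {f. (\<forall>n. f n \<in> (\<lambda>a. Q n +>\<^bsub>A\<^esub> a) ` P n) \<and> finite {n. f n \<noteq> Q n}}"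
  "f \<otimes>\<^bsub>graded_ring_of A P Q\<^esub> g = coset_conv A Q f g"
  "\<zero>\<^bsub>graded_ring_of A P Q\<^esub> = Q"
  "\<one>\<^bsub>graded_ring_of A P Q\<^esub> = homog A Q 0 \<one>\<^bsub>A\<^esub>"
  "f \<oplus>\<^bsub>graded_ring_of A P Q\<^esub> g = (\<lambda>n. f n <+>\<^bsub>A\<^esub> g n)"
  "f \<odot>\<^bsub>graded_ring_of A P Q\<^esub> g = coset_conv A Q f g"
  "hcomp (graded_ring_of A P Q) k = {f \<in> carrier (graded_ring_of A P Q). \<forall>n. n \<noteq> k \<longrightarrow> f n = Q n}"
  by (auto simp: graded_ring_of_def Let_def homog_def fun_eq_iff)

locale graded_pair = cring R for R (structure) +
  fixes P Q :: "nat \<Rightarrow> 'a set"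
  assumes P_ideal: "ideal (P n) R" and Q_ideal: "ideal (Q n) R" and Q_sub: "Q n \<subseteq> P n"
    and PP: "a \<in> P i \<Longrightarrow> b \<in> P j \<Longrightarrow> a \<otimes> b \<in> P (i + j)"
    and PQ: "a \<in> P i \<Longrightarrow> b \<in> Q j \<Longrightarrow> a \<otimes> b \<in> Q (i + j)"
begin

abbreviation "Gr \<equiv> graded_ring_of R P Q"

lemma P_carrier: "a \<in> P n \<Longrightarrow> a \<in> carrier R"
  using ideal_subset[OF P_ideal] by blast

lemma Q_carrier: "a \<in> Q n \<Longrightarrow> a \<in> carrier R"
  using Q_sub P_carrier by blast

lemma Q_mem: "Q n +> a = Q n \<longleftrightarrow> a \<in> Q n" if "a \<in> P n"
  using coset_self[OF Q_ideal P_carrier[OF that]] .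

lemma Q_eq: "Q n +> a = Q n +> b \<longleftrightarrow> a \<ominus> b \<in> Q n" if "a \<in> P n" "b \<in> P n"
  using coset_eq_iff[OF Q_ideal P_carrier[OF that(1)] P_carrier[OF that(2)]] .

lemma Q_add: "(Q n +> a) <+>\<^bsub>R\<^esub> (Q n +> b) = Q n +> (a \<oplus> b)" if "a \<in> P n" "b \<in> P n"
  using abelian_subgroup.a_rcos_sum[OF abelian_subgroupI3[OF ideal.axioms(1)[OF Q_ideal] is_abelian_group]]
    P_carrier that by blast

lemma Q_zero: "Q n +> \<zero> = Q n"
  using a_coset_add_zero[OF ideal_subset[OF Q_ideal]] .

lemma P_zero: "\<zero> \<in> P n" and Q_zero_mem: "\<zero> \<in> Q n"
  using additive_subgroup.zero_closed ideal.axioms(1) P_ideal Q_ideal by metis+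

lemma P_add: "a \<in> P n \<Longrightarrow> b \<in> P n \<Longrightarrow> a \<oplus> b \<in> P n"
  using additive_subgroup.a_closed ideal.axioms(1) P_ideal by metis

lemma Q_Q: "Q n <+>\<^bsub>R\<^esub> Q n = Q n"
  using Q_add[OF P_zero P_zero] by (simp add: Q_zero)

lemma P_neg: "a \<in> P n \<Longrightarrow> \<ominus> a \<in> P n"
  using additive_subgroup.a_inv_closed ideal.axioms(1) P_ideal by metis

text \<open>Coset convolution is computed on representatives. The left factor may consist of cosets of
  smaller ideals \<open>S i\<close>, so that the result covers both the multiplication of a graded ring of cosets and the action of
  the fiber cone on the tangent cone.\<close>

lemma coset_conv_repr:
  assumes S: "\<And>i. ideal (S i) R" "\<And>i. S i \<subseteq> Q i"
    and a: "\<And>i. a i \<in> P i" and b: "\<And>i. b i \<in> P i"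
  shows "coset_conv R Q (\<lambda>i. S i +> a i) (\<lambda>i. Q i +> b i) n = Q n +> (\<Oplus>i\<in>{..n}. a i \<otimes> b (n - i))"
proof -
  interpret Qn: ideal "Q n" R by (rule Q_ideal)
  have ab: "a i \<otimes> b j \<in> carrier R" for i j
    using P_carrier[OF a] P_carrier[OF b] by simp
  have step: "rcoset_mult R (Q n) (S i +> a i) (Q (n - i) +> b (n - i)) = Q n +> (a i \<otimes> b (n - i))" if "i \<le> n" for i
  proof -
    have ac: "a i \<in> carrier R" "b (n - i) \<in> carrier R" using a b P_carrier by auto
    have "Q n +> (y \<otimes> z) = Q n +> (a i \<otimes> b (n - i))"
      if y: "y \<in> S i +> a i" and z: "z \<in> Q (n - i) +> b (n - i)" for y z
    proof -
      obtain s where s: "s \<in> S i" "y = s \<oplus> a i" using y by (auto simp: a_r_coset_def')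
      obtain q where q: "q \<in> Q (n - i)" "z = q \<oplus> b (n - i)" using z by (auto simp: a_r_coset_def')
      have sc: "s \<in> Q i" "s \<in> carrier R" "q \<in> carrier R" "s \<in> P i"
        using s(1) q(1) S(2)[of i] Q_carrier Q_sub by blast+
      have zP: "z \<in> P (n - i)" unfolding q(2) using q(1) Q_sub b by (intro P_add) auto
      have "z \<otimes> s \<in> Q (n - i + i)" using PQ[OF zP sc(1)] .
      moreover have "a i \<otimes> q \<in> Q (i + (n - i))" using PQ[OF a q(1)] .
      ultimately have "z \<otimes> s \<oplus> a i \<otimes> q \<in> Q n" using \<open>i \<le> n\<close> by simp
      moreover have "y \<otimes> z \<ominus> a i \<otimes> b (n - i) = z \<otimes> s \<oplus> a i \<otimes> q"
        unfolding s(2) q(2) using ac sc by algebra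
      moreover have "y \<otimes> z \<in> carrier R" unfolding s(2) q(2) using ac sc by simp
      ultimately show ?thesis using coset_eq_iff[OF Q_ideal] ac by simp
    qed
    moreover have "a i \<in> S i +> a i" "b (n - i) \<in> Q (n - i) +> b (n - i)"
      using mem_coset_iff[OF S(1)] mem_coset_iff[OF Q_ideal] ac by simp_all
    ultimately show ?thesis unfolding rcoset_mult_def by blast
  qed
  interpret h: ring_hom_cring R "R Quot Q n" "(+>) (Q n)"
    by (rule Qn.rcos_ring_hom_cring[OF is_cring])
  have "coset_conv R Q (\<lambda>i. S i +> a i) (\<lambda>i. Q i +> b i) n
    = (\<Oplus>\<^bsub>R Quot Q n\<^esub>i\<in>{..n}. Q n +> (a i \<otimes> b (n - i)))"
    unfolding coset_conv_def using ab step
    by (intro h.S.finsum_cong') (auto intro!: h.hom_closed simp del: h.hom_mult)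
  also have "\<dots> = Q n +> (\<Oplus>i\<in>{..n}. a i \<otimes> b (n - i))"
    using ab by (subst h.hom_finsum) (auto simp: comp_def simp del: h.hom_mult)
  finally show ?thesis .
qed

text \<open>A homogeneous factor leaves a single term of the convolution, so its action is a shift
  combined with a multiplication. Only such factors occur below.\<close>

lemma coset_conv_homog_left:
  assumes S: "\<And>i. ideal (S i) R" "\<And>i. S i \<subseteq> Q i" and p: "p \<in> P d" and b: "\<And>i. b i \<in> P i"
  shows "coset_conv R Q (homog R S d p) (\<lambda>i. Q i +> b i) =
    (\<lambda>n. if d \<le> n then Q n +> (p \<otimes> b (n - d)) else Q n)"
proof
  fix n
  let ?a = "\<lambda>i. if i = d then p else \<zero>"
  have eq: "homog R S d p = (\<lambda>i. S i +> ?a i)"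
    using a_coset_add_zero[OF ideal_subset[OF S(1)]] by (auto simp: homog_def fun_eq_iff)
  have a: "?a i \<in> P i" for i using p P_zero by simp
  have pb: "p \<otimes> b j \<in> carrier R" "b j \<in> carrier R" for j using P_carrier[OF p] P_carrier[OF b] by simp_all
  have "(\<Oplus>i\<in>{..n}. ?a i \<otimes> b (n - i)) = (\<Oplus>i\<in>{..n}. if d = i then p \<otimes> b (n - i) else \<zero>)"
    using pb by (intro finsum_cong') auto
  also have "\<dots> = (if d \<le> n then p \<otimes> b (n - d) else \<zero>)"
    using pb by (cases "d \<le> n") (auto simp: finsum_singleton Pi_def intro!: add.finprod_one_eqI)
  finally have "(\<Oplus>i\<in>{..n}. ?a i \<otimes> b (n - i)) = (if d \<le> n then p \<otimes> b (n - d) else \<zero>)" .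
  then show "coset_conv R Q (homog R S d p) (\<lambda>i. Q i +> b i) n =
    (if d \<le> n then Q n +> (p \<otimes> b (n - d)) else Q n)"
    using coset_conv_repr[of S ?a b n, OF S a b] unfolding eq by (simp add: Q_zero)
qed

lemma coset_conv_homog_right:
  assumes p: "p \<in> P d" and b: "\<And>i. b i \<in> P i"
  shows "coset_conv R Q (\<lambda>i. Q i +> b i) (homog R Q d p) =
    (\<lambda>n. if d \<le> n then Q n +> (b (n - d) \<otimes> p) else Q n)"
proof
  fix n
  let ?a = "\<lambda>i. if i = d then p else \<zero>"
  have eq: "homog R Q d p = (\<lambda>i. Q i +> ?a i)"
    by (auto simp: homog_def Q_zero fun_eq_iff)
  have a: "?a i \<in> P i" for i using p P_zero by simp
  have pb: "b j \<otimes> p \<in> carrier R" "b j \<in> carrier R" for j using P_carrier[OF p] P_carrier[OF b] by simp_all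
  have "(\<Oplus>i\<in>{..n}. b i \<otimes> ?a (n - i)) = (\<Oplus>i\<in>{..n}. if n - d = i then (if d \<le> n then b i \<otimes> p else \<zero>) else \<zero>)"
    using pb by (intro finsum_cong') auto
  also have "\<dots> = (if d \<le> n then b (n - d) \<otimes> p else \<zero>)"
    using pb by (subst finsum_singleton) auto
  finally have "(\<Oplus>i\<in>{..n}. b i \<otimes> ?a (n - i)) = (if d \<le> n then b (n - d) \<otimes> p else \<zero>)" .
  then show "coset_conv R Q (\<lambda>i. Q i +> b i) (homog R Q d p) n =
    (if d \<le> n then Q n +> (b (n - d) \<otimes> p) else Q n)"
    using coset_conv_repr[of Q b ?a n, OF Q_ideal _ b a] unfolding eq by (simp add: Q_zero)
qed

text \<open>The zero coset is represented by zero, so finiteness of the support passes to every sequence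
  built by multiplying the representatives.\<close>

lemma carrier_repr:
  assumes "f \<in> carrier Gr"
  shows "\<exists>b. (\<forall>i. b i \<in> P i) \<and> (\<forall>i. f i = Q i \<longrightarrow> b i = \<zero>) \<and> f = (\<lambda>i. Q i +> b i)"
proof -
  have "\<forall>i. \<exists>c. c \<in> P i \<and> (f i = Q i \<longrightarrow> c = \<zero>) \<and> f i = Q i +> c"
  proof
    fix i
    show "\<exists>c. c \<in> P i \<and> (f i = Q i \<longrightarrow> c = \<zero>) \<and> f i = Q i +> c"
    proof (cases "f i = Q i")
      case True
      then show ?thesis using P_zero Q_zero by auto
    next
      case False
      then show ?thesis using assms by (auto simp: graded_ring_of_simps)
    qed
  qed
  then show ?thesis unfolding choice_iff by (auto simp: fun_eq_iff)
qed

lemma carrierI: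
  assumes "\<And>i. b i \<in> P i" "finite {i. b i \<notin> Q i}"
  shows "(\<lambda>i. Q i +> b i) \<in> carrier Gr"
  using assms Q_mem by (auto simp: graded_ring_of_simps)

lemma hcomp_sub: "hcomp Gr n \<subseteq> carrier Gr"
  by (auto simp: graded_ring_of_simps)

lemma homog_mem: "a \<in> P n \<Longrightarrow> homog R Q n a \<in> hcomp Gr n"
proof -
  assume a: "a \<in> P n"
  have "{k. (Q(n := Q n +> a)) k \<noteq> Q k} \<subseteq> {n}" by auto
  then have "finite {k. (Q(n := Q n +> a)) k \<noteq> Q k}" by (rule finite_subset) simp
  then show ?thesis using a P_zero Q_zero by (auto simp: graded_ring_of_simps homog_def intro!: image_eqI)
qed

lemma hcompE:
  assumes "f \<in> hcomp Gr n"
  shows "\<exists>a\<in>P n. f = homog R Q n a"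
proof -
  have "f n \<in> (\<lambda>a. Q n +> a) ` P n" using assms by (simp add: graded_ring_of_simps)
  then obtain a where "a \<in> P n" "f n = Q n +> a" by blast
  moreover have "\<forall>k. k \<noteq> n \<longrightarrow> f k = Q k" using assms by (auto simp: graded_ring_of_simps)
  ultimately show ?thesis by (intro bexI[of _ a]) (auto simp: homog_def fun_eq_iff)
qed

lemma homog_eq_iff:
  assumes "a \<in> P n" "b \<in> P n"
  shows "homog R Q n a = homog R Q n b \<longleftrightarrow> a \<ominus> b \<in> Q n"
  unfolding Q_eq[OF assms, symmetric] homog_def by (metis fun_upd_same)

lemma homog_zero: "homog R Q n \<zero> = Q"
  by (simp add: homog_def Q_zero)

lemma homog_add:
  assumes "a \<in> P n" "b \<in> P n"
  shows "homog R Q n a \<oplus>\<^bsub>Gr\<^esub> homog R Q n b = homog R Q n (a \<oplus> b)"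
  using Q_add[OF assms] by (auto simp: graded_ring_of_simps homog_def Q_Q fun_eq_iff)

lemma conv_homog:
  assumes S: "\<And>i. ideal (S i) R" "\<And>i. S i \<subseteq> Q i" and p: "p \<in> P d" and a: "a \<in> P n"
  shows "coset_conv R Q (homog R S d p) (homog R Q n a) = homog R Q (d + n) (p \<otimes> a)"
proof -
  let ?b = "\<lambda>i. if i = n then a else \<zero>"
  have "homog R Q n a = (\<lambda>i. Q i +> ?b i)" by (auto simp: homog_def Q_zero fun_eq_iff)
  moreover have "?b i \<in> P i" for i using a P_zero by simp
  ultimately have "coset_conv R Q (homog R S d p) (homog R Q n a) =
      (\<lambda>k. if d \<le> k then Q k +> (p \<otimes> ?b (k - d)) else Q k)"
    using coset_conv_homog_left[of S p d ?b, OF S p] by simp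
  then show ?thesis using P_carrier[OF p] by (auto simp: homog_def Q_zero fun_eq_iff)
qed

lemma abelian_group_Gr: "abelian_group Gr"
proof (rule abelian_groupI)
  have mem: "(\<lambda>i. Q i +> b i) \<in> carrier Gr \<longleftrightarrow> finite {i. b i \<notin> Q i}" if "\<And>i. b i \<in> P i" for b
    using that Q_mem by (auto simp: graded_ring_of_simps)
  show "f \<oplus>\<^bsub>Gr\<^esub> g \<in> carrier Gr" if fg: "f \<in> carrier Gr" "g \<in> carrier Gr" for f g
  proof -
    obtain b where b: "\<forall>i. b i \<in> P i" "f = (\<lambda>i. Q i +> b i)" using carrier_repr[OF fg(1)] by auto
    obtain c where c: "\<forall>i. c i \<in> P i" "g = (\<lambda>i. Q i +> c i)" using carrier_repr[OF fg(2)] by auto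
    have "{i. b i \<oplus> c i \<notin> Q i} \<subseteq> {i. b i \<notin> Q i} \<union> {i. c i \<notin> Q i}"
      using additive_subgroup.a_closed[OF ideal.axioms(1)[OF Q_ideal]] by blast
    moreover have "finite ({i. b i \<notin> Q i} \<union> {i. c i \<notin> Q i})" using fg b c mem by simp
    ultimately have "finite {i. b i \<oplus> c i \<notin> Q i}" by (rule finite_subset)
    then have "(\<lambda>i. Q i +> (b i \<oplus> c i)) \<in> carrier Gr" using b c P_add by (intro carrierI) auto
    then show ?thesis using b c by (simp add: graded_ring_of_simps(5) Q_add)
  qed
  show "\<zero>\<^bsub>Gr\<^esub> \<in> carrier Gr" using hcomp_sub homog_mem[OF P_zero] by (auto simp: homog_zero graded_ring_of_simps(3))
  show "f \<oplus>\<^bsub>Gr\<^esub> g \<oplus>\<^bsub>Gr\<^esub> h = f \<oplus>\<^bsub>Gr\<^esub> (g \<oplus>\<^bsub>Gr\<^esub> h)"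
    if fgh: "f \<in> carrier Gr" "g \<in> carrier Gr" "h \<in> carrier Gr" for f g h
  proof -
    obtain b where b: "\<forall>i. b i \<in> P i" "f = (\<lambda>i. Q i +> b i)" using carrier_repr[OF fgh(1)] by auto
    obtain c where c: "\<forall>i. c i \<in> P i" "g = (\<lambda>i. Q i +> c i)" using carrier_repr[OF fgh(2)] by auto
    obtain d where d: "\<forall>i. d i \<in> P i" "h = (\<lambda>i. Q i +> d i)" using carrier_repr[OF fgh(3)] by auto
    have "b i \<oplus> c i \<oplus> d i = b i \<oplus> (c i \<oplus> d i)" for i using a_assoc[OF P_carrier[of "b i" i] P_carrier[of "c i" i] P_carrier[of "d i" i]] b(1) c(1) d(1) by simp
    then show ?thesis using b c d by (simp add: graded_ring_of_simps(5) Q_add P_add)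
  qed
  show "f \<oplus>\<^bsub>Gr\<^esub> g = g \<oplus>\<^bsub>Gr\<^esub> f" if fg: "f \<in> carrier Gr" "g \<in> carrier Gr" for f g
  proof -
    obtain b where b: "\<forall>i. b i \<in> P i" "f = (\<lambda>i. Q i +> b i)" using carrier_repr[OF fg(1)] by auto
    obtain c where c: "\<forall>i. c i \<in> P i" "g = (\<lambda>i. Q i +> c i)" using carrier_repr[OF fg(2)] by auto
    have "b i \<oplus> c i = c i \<oplus> b i" for i using a_comm[OF P_carrier[of "b i" i] P_carrier[of "c i" i]] b(1) c(1) by simp
    then show ?thesis using b c by (simp add: graded_ring_of_simps(5) Q_add)
  qed
  show "\<zero>\<^bsub>Gr\<^esub> \<oplus>\<^bsub>Gr\<^esub> f = f" if fg: "f \<in> carrier Gr" for f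
  proof -
    obtain b where b: "\<forall>i. b i \<in> P i" "f = (\<lambda>i. Q i +> b i)" using carrier_repr[OF fg(1)] by auto
    have "Q i <+>\<^bsub>R\<^esub> (Q i +> b i) = Q i +> b i" for i
      using Q_add[OF P_zero, of "b i" i] b P_carrier[of "b i" i] by (simp add: Q_zero)
    then show ?thesis using b by (simp add: graded_ring_of_simps(3,5))
  qed
  show "\<exists>g\<in>carrier Gr. g \<oplus>\<^bsub>Gr\<^esub> f = \<zero>\<^bsub>Gr\<^esub>" if fg: "f \<in> carrier Gr" for f
  proof -
    obtain b where b: "\<forall>i. b i \<in> P i" "f = (\<lambda>i. Q i +> b i)" using carrier_repr[OF fg(1)] by auto
    have "{i. \<ominus> b i \<notin> Q i} \<subseteq> {i. b i \<notin> Q i}"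
      using additive_subgroup.a_inv_closed[OF ideal.axioms(1)[OF Q_ideal]] by blast
    moreover have "finite {i. b i \<notin> Q i}" using fg b mem by simp
    ultimately have "finite {i. \<ominus> b i \<notin> Q i}" by (rule finite_subset)
    then have "(\<lambda>i. Q i +> (\<ominus> b i)) \<in> carrier Gr" using b P_neg by (intro carrierI) auto
    moreover have "(Q i +> (\<ominus> b i)) <+>\<^bsub>R\<^esub> (Q i +> b i) = Q i" for i
      using Q_add[of "\<ominus> b i" i "b i"] b P_neg P_carrier[of "b i" i] by (simp add: l_neg Q_zero)
    ultimately show ?thesis using b by (intro bexI[of _ "\<lambda>i. Q i +> (\<ominus> b i)"]) (simp_all add: graded_ring_of_simps(3,5))
  qed
qed

end

section \<open>Powers and multiples of ideals\<close>

context cring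
begin

lemma l_coset_ideal:
  assumes I: "ideal I R" and c: "c \<in> carrier R"
  shows "ideal (c <#\<^bsub>R\<^esub> I) R"
proof -
  interpret I: ideal I R by fact
  have mem: "c \<otimes> i \<in> c <#\<^bsub>R\<^esub> I" if "i \<in> I" for i using that by (auto simp: l_coset_def)
  show ?thesis
  proof (rule idealI[OF ring_axioms])
    show "subgroup (c <#\<^bsub>R\<^esub> I) (add_monoid R)"
    proof (rule add.subgroupI)
      show "c <#\<^bsub>R\<^esub> I \<subseteq> carrier R" using c I.Icarr by (auto simp: l_coset_def)
      show "c <#\<^bsub>R\<^esub> I \<noteq> {}" using mem[OF I.zero_closed] by blast
    next
      fix a assume "a \<in> c <#\<^bsub>R\<^esub> I"
      then obtain i where i: "i \<in> I" "a = c \<otimes> i" by (auto simp: l_coset_def)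
      then have "\<ominus> a = c \<otimes> (\<ominus> i)" using c I.Icarr by (simp add: r_minus)
      then show "\<ominus> a \<in> c <#\<^bsub>R\<^esub> I" using mem i by simp
    next
      fix a b assume "a \<in> c <#\<^bsub>R\<^esub> I" "b \<in> c <#\<^bsub>R\<^esub> I"
      then obtain i j where i: "i \<in> I" "a = c \<otimes> i" "j \<in> I" "b = c \<otimes> j" by (auto simp: l_coset_def)
      then have "a \<oplus> b = c \<otimes> (i \<oplus> j)" using c I.Icarr by (simp add: r_distr)
      then show "a \<oplus> b \<in> c <#\<^bsub>R\<^esub> I" using mem i by simp
    qed
  next
    fix a y assume "a \<in> c <#\<^bsub>R\<^esub> I" and y: "y \<in> carrier R"
    then obtain i where i: "i \<in> I" "a = c \<otimes> i" by (auto simp: l_coset_def)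
    then have "y \<otimes> a = c \<otimes> (y \<otimes> i)" "a \<otimes> y = c \<otimes> (y \<otimes> i)"
      using c y I.Icarr[OF i(1)] by (simp_all add: m_ac)
    then show "y \<otimes> a \<in> c <#\<^bsub>R\<^esub> I" "a \<otimes> y \<in> c <#\<^bsub>R\<^esub> I" using mem i I.I_l_closed y by simp_all
  qed
qed

lemma one_l_coset:
  assumes "I \<subseteq> carrier R"
  shows "\<one> <#\<^bsub>R\<^esub> I = I"
proof -
  have "\<one> <#\<^bsub>R\<^esub> I = (\<lambda>i. \<one> \<otimes> i) ` I" by (auto simp: l_coset_def)
  also have "\<dots> = (\<lambda>i. i) ` I" using assms by (intro image_cong) auto
  finally show ?thesis by simp
qed

lemma ideal_pow_ideal: "ideal I R \<Longrightarrow> ideal (ideal_pow R I n) R"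
  by (induction n) (simp_all add: oneideal ideals_set_def ideal_prod_is_ideal)

lemma ideal_pow_mult:
  assumes I: "ideal I R" and "a \<in> ideal_pow R I i" "b \<in> ideal_pow R I j"
  shows "a \<otimes> b \<in> ideal_pow R I (i + j)"
proof -
  interpret M: comm_monoid "ideals_set R" by (rule ideals_set_is_comm_monoid)
  have "ideal_pow R I i \<otimes>\<^bsub>ideals_set R\<^esub> ideal_pow R I j = ideal_pow R I (i + j)"
    by (rule M.nat_pow_mult) (use I in \<open>simp add: ideals_set_def\<close>)
  then show ?thesis using ideal_prod.prod[OF assms(2,3), of R] by (simp add: ideals_set_def)
qed

lemma ideal_pow_0: "ideal_pow R I 0 = carrier R"
  by (simp add: ideals_set_def)

lemma ideal_pow_1:
  assumes "ideal I R" shows "ideal_pow R I 1 = I"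
proof -
  interpret M: comm_monoid "ideals_set R" by (rule ideals_set_is_comm_monoid)
  show ?thesis using assms M.nat_pow_eone[of I] by (simp add: ideals_set_def)
qed

lemma ideal_pow_Suc_sub:
  assumes I: "ideal I R"
  shows "ideal_pow R I (Suc n) \<subseteq> ideal_pow R I n"
  using ideal_prod_inter[OF ideal_pow_ideal[OF I, of n] I] by (simp add: ideals_set_def)

lemma pow_mem_ideal_pow:
  assumes "ideal I R" "a \<in> I"
  shows "a [^] n \<in> ideal_pow R I n"
proof (induction n)
  case 0
  then show ?case by (simp add: ideal_pow_0 del: Group.nat_pow_0)
next
  case (Suc n)
  have "a [^] n \<otimes> a \<in> ideal_pow R I (n + 1)"
    by (rule ideal_pow_mult[OF assms(1) Suc]) (use assms ideal_pow_1 in \<open>simp del: Group.nat_pow_Suc\<close>)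
  then show ?case by simp
qed

end


section \<open>The tangent cone over the fiber cone\<close>

lemma gquot_simps:
  "carrier (gquot M N) = (\<lambda>y. N +>\<^bsub>M\<^esub> y) ` carrier M"
  "\<zero>\<^bsub>gquot M N\<^esub> = N"
  "Y \<oplus>\<^bsub>gquot M N\<^esub> Z = Y <+>\<^bsub>M\<^esub> Z"
  "a \<odot>\<^bsub>gquot M N\<^esub> Y = (\<Union>y\<in>Y. N +>\<^bsub>M\<^esub> (a \<odot>\<^bsub>M\<^esub> y))"
  "hcomp (gquot M N) n = (\<lambda>y. N +>\<^bsub>M\<^esub> y) ` hcomp M n"
  by (auto simp: gquot_def quot_module_def module.extend_def gmodule.fields_def A_RCOSETS_defs a_r_coset_defs)

lemma gshift_simps:
  "carrier (gshift M d) = carrier M"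
  "\<zero>\<^bsub>gshift M d\<^esub> = \<zero>\<^bsub>M\<^esub>"
  "Y \<oplus>\<^bsub>gshift M d\<^esub> Z = Y \<oplus>\<^bsub>M\<^esub> Z"
  "a \<odot>\<^bsub>gshift M d\<^esub> Y = a \<odot>\<^bsub>M\<^esub> Y"
  "hcomp (gshift M d) n = (if d \<le> n then hcomp M (n - d) else {\<zero>\<^bsub>M\<^esub>})"
  by (auto simp: gshift_def)

text \<open>The setting for comparing the tangent cone with cyclic modules over the fiber cone: since \<open>x\<close> is a
  nonzerodivisor outside the units, \<open>x\<^sup>n \<notin> x\<^sup>nm\<close>, so the powers of \<open>x\<^sup>*\<close> do not vanish in the fiber cone.\<close>

locale nonzerodivisor_in_maximal = cring R for R (structure) +
  fixes m :: "'a set" and x :: 'a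
  assumes max: "maximalideal m R" and x_mem: "x \<in> m"
    and nzd: "a \<in> carrier R \<Longrightarrow> x \<otimes> a = \<zero> \<Longrightarrow> a = \<zero>"
begin

lemma m_ideal: "ideal m R" using maximalideal.axioms(1)[OF max] .

lemma x_carrier [simp]: "x \<in> carrier R" using ideal_subset[OF m_ideal] x_mem by blast

lemma one_notin: "\<one> \<notin> m"
  using maximalideal.I_notcarr[OF max] ideal.one_imp_carrier[OF m_ideal] by blast

lemma pow_nzd: "a \<in> carrier R \<Longrightarrow> x [^] (n::nat) \<otimes> a = \<zero> \<Longrightarrow> a = \<zero>"
proof (induction n)
  case (Suc n)
  have "x [^] Suc n \<otimes> a = x \<otimes> (x [^] n \<otimes> a)" using Suc.prems(1) by (simp add: m_ac)
  then have "x [^] n \<otimes> a = \<zero>" using Suc.prems nzd[of "x [^] n \<otimes> a"] by simp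
  then show ?case using Suc by simp
qed simp

lemma pow_notin: "x [^] n \<notin> x [^] n <#\<^bsub>R\<^esub> m" for n :: nat
proof
  assume "x [^] n \<in> x [^] n <#\<^bsub>R\<^esub> m"
  then obtain a where a: "a \<in> m" "x [^] n = x [^] n \<otimes> a" by (auto simp: l_coset_def)
  then have ac: "a \<in> carrier R" using ideal_subset[OF m_ideal] by blast
  have "x [^] n \<otimes> (\<one> \<ominus> a) = x [^] n \<ominus> x [^] n \<otimes> a" using ac by (simp add: a_minus_def r_distr r_minus)
  also have "\<dots> = \<zero>" using a(2) ac by (simp add: r_neg a_minus_def)
  finally have "\<one> \<ominus> a = \<zero>" using pow_nzd[of "\<one> \<ominus> a"] ac by simp
  then have "\<one> = a" using ac by simp
  then show False using one_notin a by simp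
qed

abbreviation "F \<equiv> fiber_cone R m x"
abbreviation "G \<equiv> tangent_cone R m"
abbreviation "PF \<equiv> \<lambda>n::nat. x [^] n <#\<^bsub>R\<^esub> carrier R"
abbreviation "QF \<equiv> \<lambda>n::nat. x [^] n <#\<^bsub>R\<^esub> m"
abbreviation "PG \<equiv> \<lambda>n::nat. ideal_pow R m n"
abbreviation "QG \<equiv> \<lambda>n::nat. ideal_pow R m (n + 1)"

sublocale F: graded_pair R PF QF
proof (rule graded_pair.intro[OF is_cring graded_pair_axioms.intro])
  show "ideal (PF n) R" "ideal (QF n) R" for n using l_coset_ideal oneideal m_ideal by simp_all
  show "QF n \<subseteq> PF n" for n using ideal_subset[OF m_ideal] by (auto simp: l_coset_def)
  show "a \<otimes> b \<in> PF (i + j)" if ab: "a \<in> PF i" "b \<in> PF j" for a b i j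
  proof -
    obtain c d where cd: "c \<in> carrier R" "d \<in> carrier R" "a = x [^] i \<otimes> c" "b = x [^] j \<otimes> d"
      using ab by (auto simp: l_coset_def)
    then have "a \<otimes> b = (x [^] i \<otimes> x [^] j) \<otimes> (c \<otimes> d)" by (simp add: m_ac)
    then have "a \<otimes> b = x [^] (i + j) \<otimes> (c \<otimes> d)" by (simp add: nat_pow_mult)
    then show ?thesis using cd by (auto simp: l_coset_def)
  qed
  show "a \<otimes> b \<in> QF (i + j)" if ab: "a \<in> PF i" "b \<in> QF j" for a b i j
  proof -
    obtain c d where cd: "c \<in> carrier R" "d \<in> m" "a = x [^] i \<otimes> c" "b = x [^] j \<otimes> d"
      using ab by (auto simp: l_coset_def)
    have dc: "d \<in> carrier R" using ideal_subset[OF m_ideal] cd(2) by blast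
    then have "a \<otimes> b = (x [^] i \<otimes> x [^] j) \<otimes> (c \<otimes> d)" using cd by (simp add: m_ac)
    then have "a \<otimes> b = x [^] (i + j) \<otimes> (c \<otimes> d)" by (simp add: nat_pow_mult)
    then show ?thesis using ideal.I_l_closed[OF m_ideal cd(2,1)] by (auto simp: l_coset_def)
  qed
qed

sublocale G: graded_pair R PG QG
proof (rule graded_pair.intro[OF is_cring graded_pair_axioms.intro])
  show "ideal (PG n) R" "ideal (QG n) R" for n using ideal_pow_ideal[OF m_ideal] by blast+
  show "QG n \<subseteq> PG n" for n using ideal_pow_Suc_sub[OF m_ideal] by simp
  show "a \<otimes> b \<in> PG (i + j)" if "a \<in> PG i" "b \<in> PG j" for a b i j
    using ideal_pow_mult[OF m_ideal that] .
  show "a \<otimes> b \<in> QG (i + j)" if "a \<in> PG i" "b \<in> QG j" for a b i j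
    using ideal_pow_mult[OF m_ideal that] by (simp only: add.assoc)
qed

lemma QF_sub_QG: "QF n \<subseteq> QG n"
  using ideal_pow_mult[OF m_ideal pow_mem_ideal_pow[OF m_ideal x_mem], of _ 1]
  unfolding ideal_pow_1[OF m_ideal] by (auto simp: l_coset_def simp del: Group.nat_pow_Suc)

text \<open>The fiber cone is generated by its constants, which are the classes of ring elements in degree
  0, and by \<open>x\<^sup>*\<close>.\<close>

definition cst :: "'a \<Rightarrow> nat \<Rightarrow> 'a set" where "cst c = homog R QF 0 c"
definition xstar :: "nat \<Rightarrow> 'a set" where "xstar = homog R QF 1 x"

lemma initial_form_eq: "initial_form R m x = xstar"
  by (auto simp: initial_form_def xstar_def homog_def fun_eq_iff)

lemma pow_mem_PF [simp]: "c \<in> carrier R \<Longrightarrow> x [^] n \<otimes> c \<in> PF n"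
  by (auto simp: l_coset_def)

lemma PF0 [simp]: "\<one> <#\<^bsub>R\<^esub> carrier R = carrier R"
  by (rule one_l_coset) simp

lemma QF0 [simp]: "\<one> <#\<^bsub>R\<^esub> m = m"
  by (rule one_l_coset[OF ideal_subset[OF m_ideal]])

lemma x_PF1: "x \<in> PF 1" using pow_mem_PF[OF one_closed, of 1] by simp

lemma cst_G:
  assumes "c \<in> carrier R" "a \<in> PG n"
  shows "cst c \<odot>\<^bsub>G\<^esub> homog R QG n a = homog R QG n (c \<otimes> a)"
  using G.conv_homog[of QF c 0 a n, OF F.Q_ideal QF_sub_QG] assms
  by (simp add: tangent_cone_def graded_ring_of_simps cst_def ideal_pow_0 del: Group.nat_pow_Suc Group.nat_pow_0)

lemma xstar_G:
  assumes "a \<in> PG n"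
  shows "xstar \<odot>\<^bsub>G\<^esub> homog R QG n a = homog R QG (Suc n) (x \<otimes> a)"
  using G.conv_homog[of QF x 1 a n, OF F.Q_ideal QF_sub_QG] assms x_mem ideal_pow_1[OF m_ideal]
  by (simp add: tangent_cone_def graded_ring_of_simps xstar_def del: Group.nat_pow_Suc)

lemma conv_F:
  assumes "p \<in> PF d" "a \<in> PF n"
  shows "homog R QF d p \<odot>\<^bsub>F\<^esub> homog R QF n a = homog R QF (d + n) (p \<otimes> a)"
  using F.conv_homog[of QF p d a n, OF F.Q_ideal _ assms]
  by (simp add: fiber_cone_def graded_ring_of_simps)

lemma cst_mem: "c \<in> carrier R \<Longrightarrow> cst c \<in> carrier F"
  and xstar_mem: "xstar \<in> carrier F"
  using F.homog_mem[of c 0] F.homog_mem[OF x_PF1] F.hcomp_sub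
  by (auto simp: cst_def xstar_def fiber_cone_def)

lemma fiber_cone_Gr: "F = F.Gr" by (simp add: fiber_cone_def)

lemma xstar_pow: "xstar [^]\<^bsub>F\<^esub> j = homog R QF j (x [^] j)" for j :: nat
proof (induction j)
  case 0
  then show ?case by (simp add: fiber_cone_Gr graded_ring_of_simps)
next
  case (Suc j)
  have "xstar [^]\<^bsub>F\<^esub> Suc j = homog R QF j (x [^] j) \<odot>\<^bsub>F\<^esub> homog R QF 1 x"
    using Suc by (simp add: fiber_cone_Gr graded_ring_of_simps xstar_def)
  also have "\<dots> = homog R QF (j + 1) (x [^] j \<otimes> x)"
    using pow_mem_PF[OF one_closed, of j] x_PF1 by (intro conv_F) auto
  finally show ?case by simp
qed

text \<open>The elements of order at least \<open>j\<close> in the polynomial ring \<open>F\<close>. This describes the ideal generated by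
  \<open>(x\<^sup>*)\<^sup>j\<close> by its components, so its cosets are determined by the components below \<open>j\<close>.\<close>

definition N :: "nat \<Rightarrow> (nat \<Rightarrow> 'a set) set" where
  "N j = {f \<in> carrier F. \<forall>k<j. f k = QF k}"

text \<open>Multiplication by \<open>(x\<^sup>*)\<^sup>j\<close> shifts by \<open>j\<close>, and every element of \<open>x\<^sup>n\<^sup>+\<^sup>jA\<close> is \<open>x\<^sup>j\<close> times an element of
  \<open>x\<^sup>nA\<close>, so a sequence starting in degree \<open>j\<close> can be shifted back.\<close>

lemma PIdl_xstar_pow: "PIdl\<^bsub>F\<^esub> (initial_form R m x [^]\<^bsub>F\<^esub> j) = N j" for j :: nat
proof -
  have xj: "x [^] j \<in> PF j" using pow_mem_PF[OF one_closed, of j] by simp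
  have right: "(\<lambda>i. QF i +> b i) \<otimes>\<^bsub>F\<^esub> homog R QF j (x [^] j) =
      (\<lambda>n. if j \<le> n then QF n +> (b (n - j) \<otimes> x [^] j) else QF n)" if "\<And>i. b i \<in> PF i" for b
    using F.coset_conv_homog_right[OF xj that] by (simp add: fiber_cone_Gr graded_ring_of_simps(2))
  have "y \<otimes>\<^bsub>F\<^esub> homog R QF j (x [^] j) \<in> N j" if y: "y \<in> carrier F" for y
  proof -
    obtain b where b: "\<And>i. b i \<in> PF i" "\<And>i. y i = QF i \<Longrightarrow> b i = \<zero>" "y = (\<lambda>i. QF i +> b i)"
      using F.carrier_repr y unfolding fiber_cone_Gr by blast
    let ?c = "\<lambda>n. if j \<le> n then b (n - j) \<otimes> x [^] j else \<zero>"
    have eq: "y \<otimes>\<^bsub>F\<^esub> homog R QF j (x [^] j) = (\<lambda>n. QF n +> ?c n)"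
      unfolding b(3) right[OF b(1)] by (auto simp: fun_eq_iff F.Q_zero)
    have c: "?c n \<in> PF n" for n
      using F.PP[OF b(1)[of "n - j"] xj] F.P_zero by (cases "j \<le> n") simp_all
    have "finite {n. y n \<noteq> QF n}" using y by (simp add: fiber_cone_Gr graded_ring_of_simps)
    then have "finite ((\<lambda>n. n + j) ` {n. y n \<noteq> QF n})" by simp
    moreover have "{n. ?c n \<notin> QF n} \<subseteq> (\<lambda>n. n + j) ` {n. y n \<noteq> QF n}"
    proof
      fix n assume n: "n \<in> {n. ?c n \<notin> QF n}"
      then have jn: "j \<le> n" using F.Q_zero_mem by (auto split: if_splits)
      have "y (n - j) \<noteq> QF (n - j)"
      proof
        assume "y (n - j) = QF (n - j)"
        then have "?c n = \<zero>" using b(2) by simp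
        then show False using n F.Q_zero_mem by simp
      qed
      then show "n \<in> (\<lambda>n. n + j) ` {n. y n \<noteq> QF n}" using jn by (intro image_eqI[of _ _ "n - j"]) auto
    qed
    ultimately have fin: "finite {n. ?c n \<notin> QF n}" by (rule rev_finite_subset)
    then have "(\<lambda>n. QF n +> ?c n) \<in> carrier F" unfolding fiber_cone_Gr by (rule F.carrierI[OF c])
    then show ?thesis unfolding N_def eq by (auto simp: F.Q_zero)
  qed
  moreover have "\<exists>y\<in>carrier F. f = y \<otimes>\<^bsub>F\<^esub> homog R QF j (x [^] j)" if f: "f \<in> N j" for f
  proof -
    have "f \<in> carrier F.Gr" using f by (simp add: N_def fiber_cone_Gr)
    then obtain b where b: "\<And>i. b i \<in> PF i" "\<And>i. f i = QF i \<Longrightarrow> b i = \<zero>" "f = (\<lambda>i. QF i +> b i)"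
      using F.carrier_repr by blast
    have "\<exists>c. c \<in> carrier R \<and> (f i = QF i \<longrightarrow> c = \<zero>) \<and> b i = x [^] i \<otimes> c" for i
      using b(1)[of i] b(2)[of i] by (cases "f i = QF i") (auto simp: l_coset_def)
    then obtain c where c: "\<And>i. c i \<in> carrier R" "\<And>i. f i = QF i \<Longrightarrow> c i = \<zero>" "\<And>i. b i = x [^] i \<otimes> c i"
      by metis
    let ?b = "\<lambda>n. x [^] n \<otimes> c (n + j)"
    have b': "?b n \<in> PF n" for n using c by simp
    have "finite {n. f n \<noteq> QF n}" using f by (simp add: N_def fiber_cone_Gr graded_ring_of_simps)
    then have "finite ((\<lambda>n. n - j) ` {n. f n \<noteq> QF n})" by simp
    moreover have "{n. ?b n \<notin> QF n} \<subseteq> (\<lambda>n. n - j) ` {n. f n \<noteq> QF n}"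
    proof
      fix n assume n: "n \<in> {n. ?b n \<notin> QF n}"
      have "f (n + j) \<noteq> QF (n + j)"
      proof
        assume "f (n + j) = QF (n + j)"
        then have "?b n = \<zero>" using c(2) by simp
        then show False using n F.Q_zero_mem by simp
      qed
      then show "n \<in> (\<lambda>n. n - j) ` {n. f n \<noteq> QF n}" by (intro image_eqI[of _ _ "n + j"]) auto
    qed
    ultimately have fin: "finite {n. ?b n \<notin> QF n}" by (rule rev_finite_subset)
    have "(\<lambda>i. QF i +> ?b i) \<in> carrier F" unfolding fiber_cone_Gr by (rule F.carrierI[OF b' fin])
    moreover have "f n = (if j \<le> n then QF n +> (?b (n - j) \<otimes> x [^] j) else QF n)" for n
    proof (cases "j \<le> n")
      case True
      have "?b (n - j) \<otimes> x [^] j = (x [^] (n - j) \<otimes> x [^] j) \<otimes> c n"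
        using c(1)[of n] True by (simp add: m_ac)
      also have "\<dots> = b n" using True c(3) by (simp add: nat_pow_mult)
      finally show ?thesis using True b(3) by simp
    next
      case False
      then show ?thesis using f by (simp add: N_def)
    qed
    then have "f = (\<lambda>i. QF i +> ?b i) \<otimes>\<^bsub>F\<^esub> homog R QF j (x [^] j)"
      unfolding right[OF b'] by blast
    ultimately show ?thesis by blast
  qed
  ultimately show ?thesis unfolding initial_form_eq xstar_pow cgenideal_def by blast
qed

end

section \<open>Cyclic graded modules over the fiber cone\<close>

text \<open>What the proof uses about the summands of the tangent cone, free and torsion alike: a graded
  module with generator \<open>u\<close> of degree \<open>d\<close>, in which \<open>x\<^sup>*\<close> maps each component from degree \<open>d\<close> on onto the next one and whose degree-\<open>d\<close>
  component is spanned by \<open>u\<close> over the residue field. The last five assumptions are those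
  instances of the module axioms, for constants, \<open>x\<^sup>*\<close> and zero, that the computations with coordinates use.\<close>

locale cyclic_summand = nonzerodivisor_in_maximal R m x
  for R :: "('a, 'b) ring_scheme" (structure) and m x +
  fixes M :: "(nat \<Rightarrow> 'a set, 'c) gmodule" and d :: nat and u :: 'c
  assumes hcomp_carrier: "hcomp M n \<subseteq> carrier M"
    and zero_hcomp: "\<zero>\<^bsub>M\<^esub> \<in> hcomp M n"
    and hcomp_low: "n < d \<Longrightarrow> hcomp M n = {\<zero>\<^bsub>M\<^esub>}"
    and u_hcomp: "u \<in> hcomp M d"
    and u_nonzero: "u \<noteq> \<zero>\<^bsub>M\<^esub>"
    and xstar_onto: "d \<le> n \<Longrightarrow> y \<in> hcomp M (Suc n) \<Longrightarrow> \<exists>z\<in>hcomp M n. y = xstar \<odot>\<^bsub>M\<^esub> z"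
    and u_gen: "y \<in> hcomp M d \<Longrightarrow> \<exists>c\<in>carrier R. y = cst c \<odot>\<^bsub>M\<^esub> u"
    and zero_zero: "\<zero>\<^bsub>M\<^esub> \<oplus>\<^bsub>M\<^esub> \<zero>\<^bsub>M\<^esub> = \<zero>\<^bsub>M\<^esub>"
    and cst_smult_zero: "c \<in> carrier R \<Longrightarrow> cst c \<odot>\<^bsub>M\<^esub> \<zero>\<^bsub>M\<^esub> = \<zero>\<^bsub>M\<^esub>"
    and xstar_smult_zero: "xstar \<odot>\<^bsub>M\<^esub> \<zero>\<^bsub>M\<^esub> = \<zero>\<^bsub>M\<^esub>"
    and cst_minus: "c \<in> carrier R \<Longrightarrow> cst c \<odot>\<^bsub>M\<^esub> u \<oplus>\<^bsub>M\<^esub> cst (\<ominus> c) \<odot>\<^bsub>M\<^esub> u = \<zero>\<^bsub>M\<^esub>"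
    and cst_zero_smult: "y \<in> carrier M \<Longrightarrow> cst \<zero> \<odot>\<^bsub>M\<^esub> y = \<zero>\<^bsub>M\<^esub>"

context nonzerodivisor_in_maximal
begin

lemma homog_smult_F:
  assumes "p \<in> PF d" "\<And>i. b i \<in> PF i"
  shows "homog R QF d p \<odot>\<^bsub>F\<^esub> (\<lambda>i. QF i +> b i) = (\<lambda>n. if d \<le> n then QF n +> (p \<otimes> b (n - d)) else QF n)"
  using F.coset_conv_homog_left[of QF p d b, OF F.Q_ideal _ assms]
  by (simp add: fiber_cone_Gr graded_ring_of_simps(6))

lemma homog_smult_closed:
  assumes p: "p \<in> PF d" and y: "y \<in> carrier F"
  shows "homog R QF d p \<odot>\<^bsub>F\<^esub> y \<in> carrier F"
proof -
  have "\<exists>b. (\<forall>i. b i \<in> PF i) \<and> (\<forall>i. y i = QF i \<longrightarrow> b i = \<zero>) \<and> y = (\<lambda>i. QF i +> b i)"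
    using F.carrier_repr y unfolding fiber_cone_Gr .
  then obtain b where b: "\<And>i. b i \<in> PF i" "\<And>i. y i = QF i \<Longrightarrow> b i = \<zero>" "y = (\<lambda>i. QF i +> b i)"
    by blast
  let ?c = "\<lambda>n. if d \<le> n then p \<otimes> b (n - d) else \<zero>"
  have eq: "homog R QF d p \<odot>\<^bsub>F\<^esub> y = (\<lambda>n. QF n +> ?c n)"
    unfolding b(3) homog_smult_F[OF p b(1)] by (auto simp: fun_eq_iff F.Q_zero)
  have c: "?c n \<in> PF n" for n
    using F.PP[OF p b(1)[of "n - d"]] F.P_zero by (cases "d \<le> n") simp_all
  have "finite {n. y n \<noteq> QF n}" using y by (simp add: fiber_cone_Gr graded_ring_of_simps)
  then have "finite ((\<lambda>n. n + d) ` {n. y n \<noteq> QF n})" by simp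
  moreover have "{n. ?c n \<notin> QF n} \<subseteq> (\<lambda>n. n + d) ` {n. y n \<noteq> QF n}"
  proof
    fix n assume n: "n \<in> {n. ?c n \<notin> QF n}"
    then have dn: "d \<le> n" using F.Q_zero_mem by (auto split: if_splits)
    have "y (n - d) \<noteq> QF (n - d)"
    proof
      assume "y (n - d) = QF (n - d)"
      then have "?c n = \<zero>" using b(2) F.P_carrier[OF p] by simp
      then show False using n F.Q_zero_mem by simp
    qed
    then show "n \<in> (\<lambda>n. n + d) ` {n. y n \<noteq> QF n}" using dn by (intro image_eqI[of _ _ "n - d"]) auto
  qed
  ultimately have fin: "finite {n. ?c n \<notin> QF n}" by (rule rev_finite_subset)
  show ?thesis unfolding eq unfolding fiber_cone_Gr by (rule F.carrierI[OF c fin])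
qed

text \<open>Multiplication by a homogeneous element is well defined modulo \<open>(x\<^sup>*)\<^sup>j\<close>.\<close>

lemma homog_smult_cong:
  assumes p: "p \<in> PF d" and y: "y \<in> carrier F" "z \<in> carrier F" and eq: "\<And>k. k < j \<Longrightarrow> y k = z k" and k: "k < j"
  shows "(homog R QF d p \<odot>\<^bsub>F\<^esub> y) k = (homog R QF d p \<odot>\<^bsub>F\<^esub> z) k"
proof -
  have "\<exists>b. (\<forall>i. b i \<in> PF i) \<and> (\<forall>i. y i = QF i \<longrightarrow> b i = \<zero>) \<and> y = (\<lambda>i. QF i +> b i)" if "y \<in> carrier F" for y
    using F.carrier_repr that unfolding fiber_cone_Gr .
  then obtain b c where b: "\<And>i. b i \<in> PF i" "y = (\<lambda>i. QF i +> b i)"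
    and c: "\<And>i. c i \<in> PF i" "z = (\<lambda>i. QF i +> c i)"
    using y by meson
  show ?thesis
  proof (cases "d \<le> k")
    case True
    have "QF (k - d) +> b (k - d) = QF (k - d) +> c (k - d)" using eq[of "k - d"] k b(2) c(2) by simp
    then have bc: "b (k - d) \<ominus> c (k - d) \<in> QF (k - d)" using F.Q_eq b(1) c(1) by simp
    have carr: "p \<in> carrier R" "b (k - d) \<in> carrier R" "c (k - d) \<in> carrier R"
      using F.P_carrier p b(1) c(1) by blast+
    have "p \<otimes> (b (k - d) \<ominus> c (k - d)) \<in> QF (d + (k - d))" by (rule F.PQ[OF p bc])
    then have "p \<otimes> b (k - d) \<ominus> p \<otimes> c (k - d) \<in> QF k"
      using carr True by (simp add: a_minus_def r_distr r_minus)
    moreover have "p \<otimes> b (k - d) \<in> PF k" "p \<otimes> c (k - d) \<in> PF k"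
      using F.PP[OF p b(1)[of "k - d"]] F.PP[OF p c(1)[of "k - d"]] True by simp_all
    ultimately have "QF k +> (p \<otimes> b (k - d)) = QF k +> (p \<otimes> c (k - d))" using F.Q_eq by simp
    then show ?thesis unfolding b(2) c(2) homog_smult_F[OF p b(1)] homog_smult_F[OF p c(1)] by simp
  next
    case False
    then show ?thesis unfolding b(2) c(2) homog_smult_F[OF p b(1)] homog_smult_F[OF p c(1)] by simp
  qed
qed

lemma abelian_group_F: "abelian_group F"
  unfolding fiber_cone_Gr by (rule F.abelian_group_Gr)

lemma F_add: "(f \<oplus>\<^bsub>F\<^esub> g) k = f k <+>\<^bsub>R\<^esub> g k"
  by (simp add: fiber_cone_Gr graded_ring_of_simps(5))

lemma F_zero: "\<zero>\<^bsub>F\<^esub> = QF"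
  by (simp add: fiber_cone_Gr graded_ring_of_simps(3))

lemma N_additive_subgroup: "abelian_subgroup (N j) F"
proof (rule abelian_subgroupI3[OF additive_subgroupI abelian_group_F])
  interpret FG: abelian_group F by (rule abelian_group_F)
  show "subgroup (N j) (add_monoid F)"
  proof (rule FG.add.subgroupI)
    show "N j \<subseteq> carrier F" by (auto simp: N_def)
    have "\<zero>\<^bsub>F\<^esub> \<in> N j" using FG.zero_closed by (simp add: N_def F_zero)
    then show "N j \<noteq> {}" by blast
    show "f \<oplus>\<^bsub>F\<^esub> g \<in> N j" if "f \<in> N j" "g \<in> N j" for f g
      using that FG.a_closed by (auto simp: N_def F_add F.Q_Q)
    show "\<ominus>\<^bsub>F\<^esub> f \<in> N j" if f: "f \<in> N j" for f
    proof -
      have fc: "f \<in> carrier F" using f by (simp add: N_def)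
      have "(\<ominus>\<^bsub>F\<^esub> f) k = QF k" if k: "k < j" for k
      proof -
        have "(\<ominus>\<^bsub>F\<^esub> f \<oplus>\<^bsub>F\<^esub> f) k = QF k" using FG.l_neg[OF fc] by (simp add: F_zero)
        then have "(\<ominus>\<^bsub>F\<^esub> f) k <+>\<^bsub>R\<^esub> QF k = QF k" using f k by (simp add: N_def F_add)
        moreover have "(\<ominus>\<^bsub>F\<^esub> f \<oplus>\<^bsub>F\<^esub> \<zero>\<^bsub>F\<^esub>) k = (\<ominus>\<^bsub>F\<^esub> f) k" using fc by simp
        ultimately show ?thesis by (simp add: F_add F_zero)
      qed
      then show ?thesis using fc by (simp add: N_def)
    qed
  qed
qed

lemma N_coset:
  assumes y: "y \<in> carrier F"
  shows "N j +>\<^bsub>F\<^esub> y = {f \<in> carrier F. \<forall>k<j. f k = y k}"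
proof
  interpret FG: abelian_group F by (rule abelian_group_F)
  have l_zero: "QF k <+>\<^bsub>R\<^esub> f k = f k" if "f \<in> carrier F" for f k
    using FG.l_zero[OF that] F_add[of "\<zero>\<^bsub>F\<^esub>" f k] by (simp add: F_zero)
  show "N j +>\<^bsub>F\<^esub> y \<subseteq> {f \<in> carrier F. \<forall>k<j. f k = y k}"
    using y l_zero by (auto simp: a_r_coset_def' N_def F_add)
  show "{f \<in> carrier F. \<forall>k<j. f k = y k} \<subseteq> N j +>\<^bsub>F\<^esub> y"
  proof
    fix f assume "f \<in> {f \<in> carrier F. \<forall>k<j. f k = y k}"
    then have f: "f \<in> carrier F" "\<And>k. k < j \<Longrightarrow> f k = y k" by auto
    have "(f \<ominus>\<^bsub>F\<^esub> y) k = QF k" if "k < j" for k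
    proof -
      have "(f \<ominus>\<^bsub>F\<^esub> y) k = (y \<oplus>\<^bsub>F\<^esub> \<ominus>\<^bsub>F\<^esub> y) k" using f(2)[OF that] by (simp add: F_add a_minus_def)
      then show ?thesis using FG.r_neg[OF y] by (simp add: F_zero)
    qed
    then have "f \<ominus>\<^bsub>F\<^esub> y \<in> N j" using f(1) y by (simp add: N_def)
    moreover have "f = (f \<ominus>\<^bsub>F\<^esub> y) \<oplus>\<^bsub>F\<^esub> y" using f(1) y by (simp add: a_minus_def FG.a_assoc FG.l_neg)
    ultimately show "f \<in> N j +>\<^bsub>F\<^esub> y" unfolding a_r_coset_def' by blast
  qed
qed

lemma N_coset_eq_iff:
  assumes "y \<in> carrier F" "z \<in> carrier F"
  shows "N j +>\<^bsub>F\<^esub> y = N j +>\<^bsub>F\<^esub> z \<longleftrightarrow> (\<forall>k<j. y k = z k)"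
proof
  assume "N j +>\<^bsub>F\<^esub> y = N j +>\<^bsub>F\<^esub> z"
  moreover have "y \<in> N j +>\<^bsub>F\<^esub> y" using assms by (simp add: N_coset)
  ultimately have "y \<in> N j +>\<^bsub>F\<^esub> z" by simp
  then show "\<forall>k<j. y k = z k" using assms by (simp add: N_coset)
qed (use assms in \<open>simp add: N_coset\<close>)

lemma N_coset_smult:
  assumes p: "p \<in> PF d" and y: "y \<in> carrier F"
  shows "homog R QF d p \<odot>\<^bsub>gquot F (N j)\<^esub> (N j +>\<^bsub>F\<^esub> y) = N j +>\<^bsub>F\<^esub> (homog R QF d p \<odot>\<^bsub>F\<^esub> y)"
proof -
  have "N j +>\<^bsub>F\<^esub> (homog R QF d p \<odot>\<^bsub>F\<^esub> z) = N j +>\<^bsub>F\<^esub> (homog R QF d p \<odot>\<^bsub>F\<^esub> y)" if "z \<in> N j +>\<^bsub>F\<^esub> y" for z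
  proof -
    have z: "z \<in> carrier F" "\<And>k. k < j \<Longrightarrow> z k = y k" using that by (auto simp: N_coset[OF y])
    then show ?thesis
      using homog_smult_cong[OF p z(1) y z(2)] N_coset_eq_iff homog_smult_closed[OF p] y by simp
  qed
  moreover have "y \<in> N j +>\<^bsub>F\<^esub> y" using y by (simp add: N_coset)
  ultimately show ?thesis unfolding gquot_simps by blast
qed

text \<open>The fiber cone is itself cyclic on its unit, and the properties of a cyclic summand pass to graded
  images in which the unit stays nonzero. The map \<open>\<pi>\<close> is the identity for free summands and the
  quotient map for torsion summands.\<close>

lemma cyclic_summand_image:
  fixes M :: "(nat \<Rightarrow> 'a set, 'c) gmodule"
  assumes carr: "carrier M = \<pi> ` carrier F" and hc: "\<And>n. hcomp M n = \<pi> ` hcomp F n"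
    and zero: "\<zero>\<^bsub>M\<^esub> = \<pi> QF"
    and add: "\<And>y z. y \<in> carrier F \<Longrightarrow> z \<in> carrier F \<Longrightarrow> \<pi> y \<oplus>\<^bsub>M\<^esub> \<pi> z = \<pi> (y \<oplus>\<^bsub>F\<^esub> z)"
    and smult: "\<And>d p y. p \<in> PF d \<Longrightarrow> y \<in> carrier F \<Longrightarrow> homog R QF d p \<odot>\<^bsub>M\<^esub> \<pi> y = \<pi> (homog R QF d p \<odot>\<^bsub>F\<^esub> y)"
    and one: "\<pi> (cst \<one>) \<noteq> \<zero>\<^bsub>M\<^esub>"
  shows "cyclic_summand R m x (gshift M d) d (\<pi> (cst \<one>))"
proof (intro cyclic_summand.intro cyclic_summand_axioms.intro nonzerodivisor_in_maximal_axioms)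
  interpret FG: abelian_group F by (rule abelian_group_F)
  have QF: "QF \<in> hcomp F n" for n
    using F.homog_mem[OF F.P_zero, of n] by (simp add: F.homog_zero fiber_cone_Gr)
  have QFc: "QF \<in> carrier F" using FG.zero_closed by (simp add: F_zero)
  have sub: "hcomp F n \<subseteq> carrier F" for n unfolding fiber_cone_Gr by (rule F.hcomp_sub)
  have cstP: "c \<in> PF 0" if "c \<in> carrier R" for c using that by simp
  have one_mem: "cst \<one> \<in> hcomp F 0" using F.homog_mem[of \<one> 0] by (simp add: fiber_cone_Gr cst_def)
  have smult_QF: "homog R QF e p \<odot>\<^bsub>F\<^esub> QF = QF" if "p \<in> PF e" for p e
    using conv_F[OF that F.P_zero[of 0]] F.P_carrier[OF that] by (simp add: F.homog_zero)
  have xs: "xstar \<odot>\<^bsub>M\<^esub> \<pi> y = \<pi> (xstar \<odot>\<^bsub>F\<^esub> y)" if "y \<in> carrier F" for y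
    using smult[OF x_PF1 that] unfolding xstar_def .
  have cs: "cst c \<odot>\<^bsub>M\<^esub> \<pi> y = \<pi> (cst c \<odot>\<^bsub>F\<^esub> y)" if "c \<in> carrier R" "y \<in> carrier F" for c y
    using smult[OF cstP[OF that(1)] that(2)] unfolding cst_def .
  have cst_one: "cst c \<odot>\<^bsub>F\<^esub> cst \<one> = cst c" if "c \<in> carrier R" for c
    using conv_F[of c 0 \<one> 0] that by (simp add: cst_def)
  show "hcomp (gshift M d) n \<subseteq> carrier (gshift M d)" for n
    using sub QFc by (auto simp: gshift_simps hc carr zero)
  show "\<zero>\<^bsub>gshift M d\<^esub> \<in> hcomp (gshift M d) n" for n
    using QF by (simp add: gshift_simps hc zero)
  show "hcomp (gshift M d) n = {\<zero>\<^bsub>gshift M d\<^esub>}" if "n < d" for n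
    using that by (simp add: gshift_simps)
  show "\<pi> (cst \<one>) \<in> hcomp (gshift M d) d" using one_mem by (simp add: gshift_simps hc)
  show "\<pi> (cst \<one>) \<noteq> \<zero>\<^bsub>gshift M d\<^esub>" using one by (simp add: gshift_simps)
  show "\<exists>z\<in>hcomp (gshift M d) n. y = xstar \<odot>\<^bsub>gshift M d\<^esub> z"
    if dn: "d \<le> n" and y: "y \<in> hcomp (gshift M d) (Suc n)" for n y
  proof -
    obtain f where f: "f \<in> hcomp F (Suc n - d)" "y = \<pi> f" using dn y by (auto simp: gshift_simps hc)
    obtain a where a: "a \<in> PF (Suc n - d)" "f = homog R QF (Suc n - d) a"
      using F.hcompE f(1) unfolding fiber_cone_Gr by blast
    then obtain c where c: "c \<in> carrier R" "a = x [^] (Suc n - d) \<otimes> c" by (auto simp: l_coset_def)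
    have "x [^] (Suc n - d) = x \<otimes> x [^] (n - d)"
      using dn by (simp add: Suc_diff_le m_comm)
    then have ac: "a = x \<otimes> (x [^] (n - d) \<otimes> c)" using c by (simp add: m_assoc)
    have xc: "x [^] (n - d) \<otimes> c \<in> PF (n - d)" using c(1) by simp
    have fe: "f = xstar \<odot>\<^bsub>F\<^esub> homog R QF (n - d) (x [^] (n - d) \<otimes> c)"
      unfolding a(2) ac xstar_def conv_F[OF x_PF1 xc] using dn by (simp add: Suc_diff_le)
    have mem: "homog R QF (n - d) (x [^] (n - d) \<otimes> c) \<in> hcomp F (n - d)"
      unfolding fiber_cone_Gr by (rule F.homog_mem[OF xc])
    then have "homog R QF (n - d) (x [^] (n - d) \<otimes> c) \<in> carrier F" using sub by blast
    from xs[OF this] have "y = xstar \<odot>\<^bsub>M\<^esub> \<pi> (homog R QF (n - d) (x [^] (n - d) \<otimes> c))"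
      unfolding f(2) fe by simp
    then show ?thesis using mem dn by (auto simp: gshift_simps hc)
  qed
  show "\<exists>c\<in>carrier R. y = cst c \<odot>\<^bsub>gshift M d\<^esub> \<pi> (cst \<one>)" if y: "y \<in> hcomp (gshift M d) d" for y
  proof -
    obtain f where f: "f \<in> hcomp F 0" "y = \<pi> f" using y by (auto simp: gshift_simps hc)
    obtain c where c: "c \<in> PF 0" "f = homog R QF 0 c"
      using F.hcompE f(1) unfolding fiber_cone_Gr by blast
    have cR: "c \<in> carrier R" using c(1) by simp
    have "y = \<pi> (cst c \<odot>\<^bsub>F\<^esub> cst \<one>)" using f(2) c(2) cst_one[OF cR] by (simp add: cst_def)
    also have "\<dots> = cst c \<odot>\<^bsub>M\<^esub> \<pi> (cst \<one>)"
      using cs[OF cR cst_mem[OF one_closed]] by simp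
    finally show ?thesis using cR by (auto simp: gshift_simps)
  qed
  show "\<zero>\<^bsub>gshift M d\<^esub> \<oplus>\<^bsub>gshift M d\<^esub> \<zero>\<^bsub>gshift M d\<^esub> = \<zero>\<^bsub>gshift M d\<^esub>"
    using add[OF QFc QFc] FG.l_zero[OF QFc] by (simp add: gshift_simps zero F_zero)
  show "cst c \<odot>\<^bsub>gshift M d\<^esub> \<zero>\<^bsub>gshift M d\<^esub> = \<zero>\<^bsub>gshift M d\<^esub>" if "c \<in> carrier R" for c
    using smult[OF cstP[OF that] QFc] smult_QF[OF cstP[OF that]] by (simp add: gshift_simps zero cst_def)
  show "xstar \<odot>\<^bsub>gshift M d\<^esub> \<zero>\<^bsub>gshift M d\<^esub> = \<zero>\<^bsub>gshift M d\<^esub>"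
    using smult[OF x_PF1 QFc] smult_QF[OF x_PF1] unfolding xstar_def by (simp add: gshift_simps zero)
  show "cst c \<odot>\<^bsub>gshift M d\<^esub> \<pi> (cst \<one>) \<oplus>\<^bsub>gshift M d\<^esub> cst (\<ominus> c) \<odot>\<^bsub>gshift M d\<^esub> \<pi> (cst \<one>) = \<zero>\<^bsub>gshift M d\<^esub>"
    if c: "c \<in> carrier R" for c
  proof -
    have e: "cst b \<odot>\<^bsub>M\<^esub> \<pi> (cst \<one>) = \<pi> (cst b)" if "b \<in> carrier R" for b
      using cs[OF that cst_mem[OF one_closed]] cst_one[OF that] by simp
    have "\<pi> (cst c) \<oplus>\<^bsub>M\<^esub> \<pi> (cst (\<ominus> c)) = \<pi> (cst c \<oplus>\<^bsub>F\<^esub> cst (\<ominus> c))"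
      using add cst_mem c by simp
    also have "cst c \<oplus>\<^bsub>F\<^esub> cst (\<ominus> c) = QF"
      using F.homog_add[of c 0 "\<ominus> c"] c by (simp add: cst_def fiber_cone_Gr r_neg F.homog_zero)
    finally show ?thesis using e c by (simp add: gshift_simps zero)
  qed
  show "cst \<zero> \<odot>\<^bsub>gshift M d\<^esub> y = \<zero>\<^bsub>gshift M d\<^esub>" if y: "y \<in> carrier (gshift M d)" for y
  proof -
    obtain f where f: "f \<in> carrier F" "y = \<pi> f" using y carr by (auto simp: gshift_simps)
    have "\<exists>b. (\<forall>i. b i \<in> PF i) \<and> (\<forall>i. f i = QF i \<longrightarrow> b i = \<zero>) \<and> f = (\<lambda>i. QF i +> b i)"
      using F.carrier_repr f(1) unfolding fiber_cone_Gr .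
    then obtain b where b: "\<And>i. b i \<in> PF i" "f = (\<lambda>i. QF i +> b i)" by blast
    have "homog R QF 0 \<zero> \<odot>\<^bsub>F\<^esub> f = QF"
      unfolding b(2) homog_smult_F[OF F.P_zero b(1)] using F.P_carrier[OF b(1)] by (simp add: F.Q_zero)
    then show ?thesis using smult[OF F.P_zero[of 0] f(1)] f(2) by (simp add: gshift_simps zero cst_def)
  qed
qed

lemma cst_one_nonzero: "cst \<one> 0 \<noteq> QF 0"
  using F.Q_mem[of \<one> 0] one_notin by (simp add: cst_def homog_def)

lemma cyclic_summand_free: "cyclic_summand R m x (gshift F d) d (cst \<one>)"
proof (rule cyclic_summand_image[where \<pi> = "\<lambda>y. y"])
  show "cst \<one> \<noteq> \<zero>\<^bsub>F\<^esub>" using cst_one_nonzero unfolding F_zero by metis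
qed (simp_all add: F_zero)

lemma cyclic_summand_torsion:
  assumes "1 \<le> j"
  shows "cyclic_summand R m x (gshift (gquot F (N j)) d) d (N j +>\<^bsub>F\<^esub> cst \<one>)"
proof (rule cyclic_summand_image)
  interpret NF: abelian_subgroup "N j" F by (rule N_additive_subgroup)
  have QFc: "QF \<in> carrier F" using NF.a_subset NF.zero_closed by (auto simp: F_zero)
  have N0: "N j +>\<^bsub>F\<^esub> QF = N j" using N_coset[OF QFc, of j] N_def[of j] by (metis (no_types, lifting))
  show "\<zero>\<^bsub>gquot F (N j)\<^esub> = N j +>\<^bsub>F\<^esub> QF" using N0 by (simp add: gquot_simps)
  show "(N j +>\<^bsub>F\<^esub> y) \<oplus>\<^bsub>gquot F (N j)\<^esub> (N j +>\<^bsub>F\<^esub> z) = N j +>\<^bsub>F\<^esub> (y \<oplus>\<^bsub>F\<^esub> z)"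
    if "y \<in> carrier F" "z \<in> carrier F" for y z
    using NF.a_rcos_sum[OF that] by (simp add: gquot_simps)
  show "homog R QF d p \<odot>\<^bsub>gquot F (N j)\<^esub> (N j +>\<^bsub>F\<^esub> y) = N j +>\<^bsub>F\<^esub> (homog R QF d p \<odot>\<^bsub>F\<^esub> y)"
    if "p \<in> PF d" "y \<in> carrier F" for d p y by (rule N_coset_smult[OF that])
  have "N j +>\<^bsub>F\<^esub> cst \<one> \<noteq> N j +>\<^bsub>F\<^esub> QF"
    using N_coset_eq_iff[of "cst \<one>" QF j] cst_mem[OF one_closed] QFc cst_one_nonzero assms by auto
  then show "N j +>\<^bsub>F\<^esub> cst \<one> \<noteq> \<zero>\<^bsub>gquot F (N j)\<^esub>" using N0 by (simp add: gquot_simps)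
qed (simp_all add: gquot_simps)

text \<open>The class of \<open>(x\<^sup>*)\<^sup>j\<^sup>-\<^sup>1\<close> spans the socle of \<open>F / (x\<^sup>*)\<^sup>jF\<close>. It is nonzero because \<open>x\<close> is a
  nonzerodivisor, which gives \<open>x\<^sup>j\<^sup>-\<^sup>1 \<notin> x\<^sup>j\<^sup>-\<^sup>1m\<close>.\<close>

lemma torsion_element:
  assumes "1 \<le> j"
  shows "\<exists>w\<in>hcomp (gshift (gquot F (N j)) d) (d + (j - 1)).
    w \<noteq> \<zero>\<^bsub>gshift (gquot F (N j)) d\<^esub> \<and> xstar \<odot>\<^bsub>gshift (gquot F (N j)) d\<^esub> w = \<zero>\<^bsub>gshift (gquot F (N j)) d\<^esub>"
proof -
  interpret NF: abelian_subgroup "N j" F by (rule N_additive_subgroup)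
  have QFc: "QF \<in> carrier F" using NF.a_subset NF.zero_closed by (auto simp: F_zero)
  have N0: "N j +>\<^bsub>F\<^esub> QF = N j" using N_coset[OF QFc, of j] N_def[of j] by (metis (no_types, lifting))
  have p: "x [^] n \<in> PF n" for n using pow_mem_PF[OF one_closed, of n] by simp
  let ?w = "homog R QF (j - 1) (x [^] (j - 1))"
  have w: "?w \<in> hcomp F (j - 1)" unfolding fiber_cone_Gr by (rule F.homog_mem[OF p])
  then have wc: "?w \<in> carrier F" using F.hcomp_sub unfolding fiber_cone_Gr by blast
  have "?w (j - 1) \<noteq> QF (j - 1)" using F.Q_mem[OF p[of "j - 1"]] pow_notin by (simp add: homog_def)
  then have 1: "N j +>\<^bsub>F\<^esub> ?w \<noteq> N j" using N_coset_eq_iff[OF wc QFc, of j] N0 assms by auto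
  have "xstar \<odot>\<^bsub>gquot F (N j)\<^esub> (N j +>\<^bsub>F\<^esub> ?w) = N j +>\<^bsub>F\<^esub> (xstar \<odot>\<^bsub>F\<^esub> ?w)"
    unfolding xstar_def by (rule N_coset_smult[OF x_PF1 wc])
  also have "xstar \<odot>\<^bsub>F\<^esub> ?w = homog R QF j (x \<otimes> x [^] (j - 1))"
    unfolding xstar_def conv_F[OF x_PF1 p] using assms by simp
  also have "N j +>\<^bsub>F\<^esub> homog R QF j (x \<otimes> x [^] (j - 1)) = N j +>\<^bsub>F\<^esub> QF"
  proof (subst N_coset_eq_iff[OF _ QFc])
    have "x \<otimes> x [^] (j - 1) \<in> PF (1 + (j - 1))" by (rule F.PP[OF x_PF1 p])
    then have "x \<otimes> x [^] (j - 1) \<in> PF j" using assms by simp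
    then show "homog R QF j (x \<otimes> x [^] (j - 1)) \<in> carrier F"
      using F.homog_mem F.hcomp_sub unfolding fiber_cone_Gr by blast
  qed (simp add: homog_def)
  finally have 2: "xstar \<odot>\<^bsub>gquot F (N j)\<^esub> (N j +>\<^bsub>F\<^esub> ?w) = N j" using N0 by simp
  show ?thesis
    by (rule bexI[of _ "N j +>\<^bsub>F\<^esub> ?w"]) (use 1 2 w in \<open>auto simp: gshift_simps gquot_simps\<close>)
qed

end

section \<open>Generators of the tangent cone in a given degree\<close>

text \<open>One coordinate of an isomorphism from the tangent cone to a direct sum, read as a function on
  ring elements: \<open>\<phi> n a\<close> is the component in the summand \<open>M\<close> of the image of the class of \<open>a \<in> m\<^sup>n\<close> in degree \<open>n\<close>.\<close>

locale summand_coordinate = cyclic_summand R m x M d u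
  for R :: "('a, 'b) ring_scheme" (structure) and m x and M :: "(nat \<Rightarrow> 'a set, 'c) gmodule" and d u +
  fixes \<phi> :: "nat \<Rightarrow> 'a \<Rightarrow> 'c"
  assumes \<phi>_mem: "a \<in> PG n \<Longrightarrow> \<phi> n a \<in> hcomp M n"
    and \<phi>_add: "a \<in> PG n \<Longrightarrow> b \<in> PG n \<Longrightarrow> \<phi> n (a \<oplus> b) = \<phi> n a \<oplus>\<^bsub>M\<^esub> \<phi> n b"
    and \<phi>_cst: "c \<in> carrier R \<Longrightarrow> a \<in> PG n \<Longrightarrow> \<phi> n (c \<otimes> a) = cst c \<odot>\<^bsub>M\<^esub> \<phi> n a"
    and \<phi>_xstar: "a \<in> PG n \<Longrightarrow> \<phi> (Suc n) (x \<otimes> a) = xstar \<odot>\<^bsub>M\<^esub> \<phi> n a"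
    and \<phi>_cong: "a \<in> PG n \<Longrightarrow> b \<in> PG n \<Longrightarrow> a \<ominus> b \<in> QG n \<Longrightarrow> \<phi> n a = \<phi> n b"
begin

lemma \<phi>_zero: "\<phi> n \<zero> = \<zero>\<^bsub>M\<^esub>"
proof -
  have "\<phi> n (\<zero> \<otimes> \<zero>) = cst \<zero> \<odot>\<^bsub>M\<^esub> \<phi> n \<zero>" by (rule \<phi>_cst[OF zero_closed G.P_zero])
  also have "\<dots> = \<zero>\<^bsub>M\<^esub>" using cst_zero_smult \<phi>_mem[OF G.P_zero] hcomp_carrier by blast
  finally show ?thesis by simp
qed

lemma \<phi>_QG: "a \<in> QG n \<Longrightarrow> \<phi> n a = \<zero>\<^bsub>M\<^esub>"
  using \<phi>_cong[OF _ G.P_zero, of a n] G.Q_sub[of n] G.Q_carrier[of a n] \<phi>_zero by (auto simp: a_minus_def)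

text \<open>These kernels are the coordinate hyperplanes for dimension counting in the lattice of ideals.\<close>

lemma kernel_ideal: "ideal {a \<in> PG n. \<phi> n a = \<zero>\<^bsub>M\<^esub>} R"
proof (rule idealI[OF ring_axioms])
  let ?H = "{a \<in> PG n. \<phi> n a = \<zero>\<^bsub>M\<^esub>}"
  have smult: "c \<otimes> a \<in> ?H" if "c \<in> carrier R" "a \<in> ?H" for c a
    using that \<phi>_cst cst_smult_zero ideal.I_l_closed[OF G.P_ideal] by auto
  show "subgroup ?H (add_monoid R)"
  proof (rule add.subgroupI)
    show "?H \<subseteq> carrier R" using G.P_carrier by blast
    show "?H \<noteq> {}" using \<phi>_zero G.P_zero by blast
    show "\<ominus> a \<in> ?H" if "a \<in> ?H" for a
      using smult[of "\<ominus> \<one>" a] that G.P_carrier by (auto simp: l_minus)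
    show "a \<oplus> b \<in> ?H" if "a \<in> ?H" "b \<in> ?H" for a b
      using that \<phi>_add G.P_add zero_zero by auto
  qed
  show "c \<otimes> a \<in> ?H" "a \<otimes> c \<in> ?H" if "a \<in> ?H" "c \<in> carrier R" for a c
    using smult[OF that(2,1)] m_comm[of a c] that G.P_carrier by auto
qed

lemma \<phi>_reduce:
  assumes "a \<in> PG d" "e \<in> PG d" "\<phi> d e = u"
  shows "\<exists>c\<in>carrier R. \<phi> d (a \<ominus> c \<otimes> e) = \<zero>\<^bsub>M\<^esub>"
proof -
  obtain c where c: "c \<in> carrier R" "\<phi> d a = cst c \<odot>\<^bsub>M\<^esub> u" using u_gen[OF \<phi>_mem[OF assms(1)]] by blast
  have ec: "e \<in> carrier R" using G.P_carrier[OF assms(2)] .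
  have "a \<ominus> c \<otimes> e = a \<oplus> (\<ominus> c) \<otimes> e" using c(1) ec by (simp add: a_minus_def l_minus)
  moreover have "(\<ominus> c) \<otimes> e \<in> PG d" using ideal.I_l_closed[OF G.P_ideal assms(2)] c(1) by simp
  ultimately have "\<phi> d (a \<ominus> c \<otimes> e) = \<zero>\<^bsub>M\<^esub>"
    using \<phi>_add[OF assms(1)] \<phi>_cst[of "\<ominus> c" e d] assms(2,3) c cst_minus by simp
  then show ?thesis using c(1) by blast
qed

text \<open>In degree \<open>n + 1\<close>, only a summand generated in exactly that degree obstructs divisibility by
  \<open>x\<^sup>*\<close>: one generated in lower degree is divisible, and one generated in higher degree is zero there.\<close>

lemma \<phi>_xstar_multiple:
  assumes "a \<in> PG (Suc n)" "d = Suc n \<Longrightarrow> \<phi> (Suc n) a = \<zero>\<^bsub>M\<^esub>"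
  shows "\<exists>z\<in>hcomp M n. \<phi> (Suc n) a = xstar \<odot>\<^bsub>M\<^esub> z"
proof (cases "d \<le> n")
  case True
  then show ?thesis using xstar_onto \<phi>_mem assms(1) by blast
next
  case False
  have "\<phi> (Suc n) a = \<zero>\<^bsub>M\<^esub>"
  proof (cases "d = Suc n")
    case True
    then show ?thesis by (rule assms(2))
  next
    case neq: False
    then have "Suc n < d" using False by simp
    then show ?thesis using \<phi>_mem[OF assms(1)] hcomp_low by blast
  qed
  then show ?thesis using xstar_smult_zero zero_hcomp by (intro bexI[of _ "\<zero>\<^bsub>M\<^esub>"]) auto
qed

lemma \<phi>_xstar_image:
  assumes "b \<in> PG n" "n < d"
  shows "\<phi> (Suc n) (x \<otimes> b) = \<zero>\<^bsub>M\<^esub>"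
  using \<phi>_xstar[OF assms(1)] \<phi>_mem[OF assms(1)] hcomp_low[OF assms(2)] xstar_smult_zero by auto

end

lemma hcomp_gdirect_sum:
  assumes "finite I" "\<And>i. i \<in> I \<Longrightarrow> hcomp (M i) n \<subseteq> carrier (M i)"
  shows "hcomp (gdirect_sum I M) n = (\<Pi>\<^sub>E i\<in>I. hcomp (M i) n)"
  using assms by (auto simp: gdirect_sum_def Let_def PiE_def Pi_def)

lemma gdirect_sum_simps:
  "(f \<oplus>\<^bsub>gdirect_sum I M\<^esub> g) = (\<lambda>i\<in>I. f i \<oplus>\<^bsub>M i\<^esub> g i)"
  "(a \<odot>\<^bsub>gdirect_sum I M\<^esub> f) = (\<lambda>i\<in>I. a \<odot>\<^bsub>M i\<^esub> f i)"
  by (simp_all add: gdirect_sum_def Let_def)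

lemma gdirect_sum2_simps:
  "p \<oplus>\<^bsub>gdirect_sum2 M N\<^esub> q = (fst p \<oplus>\<^bsub>M\<^esub> fst q, snd p \<oplus>\<^bsub>N\<^esub> snd q)"
  "a \<odot>\<^bsub>gdirect_sum2 M N\<^esub> p = (a \<odot>\<^bsub>M\<^esub> fst p, a \<odot>\<^bsub>N\<^esub> snd p)"
  "hcomp (gdirect_sum2 M N) n = hcomp M n \<times> hcomp N n"
  by (simp_all add: gdirect_sum2_def case_prod_beta)

text \<open>The two families are kept apart because their elements have different types: those of a free
  summand are sequences of cosets, those of a torsion summand are sets of such sequences.\<close>

locale tangent_cone_decomposition = nonzerodivisor_in_maximal R m x
  for R :: "('a, 'b) ring_scheme" (structure) and m x +
  fixes S :: "'s set" and M :: "'s \<Rightarrow> (nat \<Rightarrow> 'a set, 'c) gmodule" and d :: "'s \<Rightarrow> nat" and u :: "'s \<Rightarrow> 'c"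
    and T :: "'t set" and M' :: "'t \<Rightarrow> (nat \<Rightarrow> 'a set, 'd) gmodule" and d' :: "'t \<Rightarrow> nat" and u' :: "'t \<Rightarrow> 'd"
  assumes finite_S: "finite S" and finite_T: "finite T"
    and cyclic_S: "s \<in> S \<Longrightarrow> cyclic_summand R m x (M s) (d s) (u s)"
    and cyclic_T: "t \<in> T \<Longrightarrow> cyclic_summand R m x (M' t) (d' t) (u' t)"
    and iso: "gmodule_iso F G (gdirect_sum2 (gdirect_sum S M) (gdirect_sum T M'))"
begin

abbreviation "D \<equiv> gdirect_sum2 (gdirect_sum S M) (gdirect_sum T M')"

text \<open>A fixed choice of isomorphism, so that the coordinate functions are constants of the locale.\<close>

definition h where "h = (SOME h. bij_betw h (carrier G) (carrier D) \<and>
        (\<forall>y\<in>carrier G. \<forall>z\<in>carrier G. h (y \<oplus>\<^bsub>G\<^esub> z) = h y \<oplus>\<^bsub>D\<^esub> h z) \<and>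
        (\<forall>a\<in>carrier F. \<forall>y\<in>carrier G. h (a \<odot>\<^bsub>G\<^esub> y) = a \<odot>\<^bsub>D\<^esub> h y) \<and>
        (\<forall>n. h ` hcomp G n = hcomp D n))"

lemma h: "bij_betw h (carrier G) (carrier D)"
  "\<And>y z. y \<in> carrier G \<Longrightarrow> z \<in> carrier G \<Longrightarrow> h (y \<oplus>\<^bsub>G\<^esub> z) = h y \<oplus>\<^bsub>D\<^esub> h z"
  "\<And>a y. a \<in> carrier F \<Longrightarrow> y \<in> carrier G \<Longrightarrow> h (a \<odot>\<^bsub>G\<^esub> y) = a \<odot>\<^bsub>D\<^esub> h y"
  "h ` hcomp G n = hcomp D n"
  using someI_ex[OF iso[unfolded gmodule_iso_def]] unfolding h_def[symmetric] by blast+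

definition \<phi> where "\<phi> n a = h (homog R QG n a)"

lemma tangent_cone_Gr: "G = G.Gr"
  by (simp add: tangent_cone_def)

lemma homog_hcomp: "a \<in> PG n \<Longrightarrow> homog R QG n a \<in> hcomp G n"
  unfolding tangent_cone_Gr by (rule G.homog_mem)

lemma homog_carrier: "a \<in> PG n \<Longrightarrow> homog R QG n a \<in> carrier G"
  using homog_hcomp G.hcomp_sub unfolding tangent_cone_Gr by blast

lemma hcomp_D: "hcomp D n = (\<Pi>\<^sub>E s\<in>S. hcomp (M s) n) \<times> (\<Pi>\<^sub>E t\<in>T. hcomp (M' t) n)"
  using hcomp_gdirect_sum[OF finite_S cyclic_summand.hcomp_carrier[OF cyclic_S]]
    hcomp_gdirect_sum[OF finite_T cyclic_summand.hcomp_carrier[OF cyclic_T]]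
  by (simp add: gdirect_sum2_simps)

lemma \<phi>_hcomp: "a \<in> PG n \<Longrightarrow> \<phi> n a \<in> hcomp D n"
  unfolding \<phi>_def h(4)[symmetric] using homog_hcomp by blast

lemma \<phi>_surj: "y \<in> hcomp D n \<Longrightarrow> \<exists>a\<in>PG n. \<phi> n a = y"
  unfolding \<phi>_def h(4)[symmetric] using G.hcompE unfolding tangent_cone_Gr by blast

lemma \<phi>_inj: "a \<in> PG n \<Longrightarrow> b \<in> PG n \<Longrightarrow> \<phi> n a = \<phi> n b \<Longrightarrow> a \<ominus> b \<in> QG n"
  using h(1) homog_carrier G.homog_eq_iff unfolding \<phi>_def bij_betw_def inj_on_def by blast

lemma \<phi>_D:
  "a \<in> PG n \<Longrightarrow> b \<in> PG n \<Longrightarrow> \<phi> n (a \<oplus> b) = \<phi> n a \<oplus>\<^bsub>D\<^esub> \<phi> n b"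
  "c \<in> carrier R \<Longrightarrow> a \<in> PG n \<Longrightarrow> \<phi> n (c \<otimes> a) = cst c \<odot>\<^bsub>D\<^esub> \<phi> n a"
  "a \<in> PG n \<Longrightarrow> \<phi> (Suc n) (x \<otimes> a) = xstar \<odot>\<^bsub>D\<^esub> \<phi> n a"
  "a \<in> PG n \<Longrightarrow> b \<in> PG n \<Longrightarrow> a \<ominus> b \<in> QG n \<Longrightarrow> \<phi> n a = \<phi> n b"
proof -
  show "\<phi> n (a \<oplus> b) = \<phi> n a \<oplus>\<^bsub>D\<^esub> \<phi> n b" if ab: "a \<in> PG n" "b \<in> PG n"
    using h(2)[OF homog_carrier[OF ab(1)] homog_carrier[OF ab(2)]] G.homog_add[OF ab]
    unfolding \<phi>_def by (simp add: tangent_cone_def)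
  show "\<phi> n (c \<otimes> a) = cst c \<odot>\<^bsub>D\<^esub> \<phi> n a" if "c \<in> carrier R" "a \<in> PG n"
    using h(3)[OF cst_mem[OF that(1)] homog_carrier[OF that(2)]] cst_G[OF that] unfolding \<phi>_def by simp
  show "\<phi> (Suc n) (x \<otimes> a) = xstar \<odot>\<^bsub>D\<^esub> \<phi> n a" if "a \<in> PG n"
    using h(3)[OF xstar_mem homog_carrier[OF that]] xstar_G[OF that] unfolding \<phi>_def by simp
  show "\<phi> n a = \<phi> n b" if "a \<in> PG n" "b \<in> PG n" "a \<ominus> b \<in> QG n"
    using G.homog_eq_iff that unfolding \<phi>_def by metis
qed

lemma coordinate_S:
  assumes s: "s \<in> S"
  shows "summand_coordinate R m x (M s) (d s) (u s) (\<lambda>n a. fst (\<phi> n a) s)"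
proof (rule summand_coordinate.intro[OF cyclic_S[OF s] summand_coordinate_axioms.intro])
  show "fst (\<phi> n a) s \<in> hcomp (M s) n" if "a \<in> PG n" for n a
    using \<phi>_hcomp[OF that] s unfolding hcomp_D by (auto simp: PiE_def Pi_def mem_Times_iff)
qed (use s \<phi>_D(4) in \<open>auto simp: \<phi>_D(1-3) gdirect_sum2_simps gdirect_sum_simps\<close>)

lemma coordinate_T:
  assumes t: "t \<in> T"
  shows "summand_coordinate R m x (M' t) (d' t) (u' t) (\<lambda>n a. snd (\<phi> n a) t)"
proof (rule summand_coordinate.intro[OF cyclic_T[OF t] summand_coordinate_axioms.intro])
  show "snd (\<phi> n a) t \<in> hcomp (M' t) n" if "a \<in> PG n" for n a
    using \<phi>_hcomp[OF that] t unfolding hcomp_D by (auto simp: PiE_def Pi_def mem_Times_iff)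
qed (use t \<phi>_D(4) in \<open>auto simp: \<phi>_D(1-3) gdirect_sum2_simps gdirect_sum_simps\<close>)

text \<open>The isomorphism is onto in each degree, so homogeneous components can be prescribed
  independently in all summands.\<close>

lemma lift_coordinates:
  assumes "\<And>s. s \<in> S \<Longrightarrow> f s \<in> hcomp (M s) n" "\<And>t. t \<in> T \<Longrightarrow> g t \<in> hcomp (M' t) n"
  shows "\<exists>a\<in>PG n. (\<forall>s\<in>S. fst (\<phi> n a) s = f s) \<and> (\<forall>t\<in>T. snd (\<phi> n a) t = g t)"
proof -
  have "(restrict f S, restrict g T) \<in> hcomp D n" unfolding hcomp_D using assms by simp
  then obtain a where "a \<in> PG n" "\<phi> n a = (restrict f S, restrict g T)" using \<phi>_surj by blast
  then show ?thesis by (intro bexI[of _ a]) auto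
qed

lemma coordinates_ext:
  assumes "a \<in> PG n" "b \<in> PG n" "\<And>s. s \<in> S \<Longrightarrow> fst (\<phi> n a) s = fst (\<phi> n b) s"
    "\<And>t. t \<in> T \<Longrightarrow> snd (\<phi> n a) t = snd (\<phi> n b) t"
  shows "a \<ominus> b \<in> QG n"
proof (rule \<phi>_inj[OF assms(1,2)])
  have *: "\<phi> n a \<in> hcomp D n" "\<phi> n b \<in> hcomp D n" using \<phi>_hcomp assms by auto
  show "\<phi> n a = \<phi> n b"
  proof (rule prod_eqI)
    show "fst (\<phi> n a) = fst (\<phi> n b)"
      by (rule PiE_ext[of _ S "\<lambda>s. hcomp (M s) n"]) (use * assms(3) in \<open>auto simp: hcomp_D mem_Times_iff\<close>)
    show "snd (\<phi> n a) = snd (\<phi> n b)"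
      by (rule PiE_ext[of _ T "\<lambda>t. hcomp (M' t) n"]) (use * assms(4) in \<open>auto simp: hcomp_D mem_Times_iff\<close>)
  qed
qed

lemma zero_S: "s \<in> S \<Longrightarrow> \<zero>\<^bsub>M s\<^esub> \<in> hcomp (M s) n" and zero_T: "t \<in> T \<Longrightarrow> \<zero>\<^bsub>M' t\<^esub> \<in> hcomp (M' t) n"
  using cyclic_summand.zero_hcomp[OF cyclic_S] cyclic_summand.zero_hcomp[OF cyclic_T] by blast+

text \<open>The number of summands generated in degree \<open>n + 1\<close> is the dimension of
  \<open>m\<^sup>n\<^sup>+\<^sup>1 / (x m\<^sup>n + m\<^sup>n\<^sup>+\<^sup>2)\<close>. The coordinates at these summands are linearly independent on
  \<open>m\<^sup>n\<^sup>+\<^sup>1\<close>, and their common kernel consists of the elements whose class is divisible by \<open>x\<^sup>*\<close>. The free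
  summands are counted from \<open>m\<^sup>n\<^sup>+\<^sup>1\<close> down to the common kernel of their coordinates, and the torsion
  summands from there.\<close>

lemma number_of_generators:
  "interval_length R ((x <#\<^bsub>R\<^esub> PG n) <+>\<^bsub>R\<^esub> PG (n + 2)) (PG (n + 1))
     = enat (card {s \<in> S. d s = n + 1} + card {t \<in> T. d' t = n + 1})"
proof -
  \<comment> \<open>Unfolding this rule would turn \<open>m\<^sup>n\<^sup>+\<^sup>1\<close> into an ideal product, on which the coordinate lemmas do not match.\<close>
  note [simp del] = Group.nat_pow_Suc
  let ?I = "PG (n + 1)" and ?S = "{s \<in> S. d s = n + 1}" and ?T = "{t \<in> T. d' t = n + 1}"
  \<comment> \<open>Kernels of the coordinates at the free and at the torsion summands.\<close>
  let ?H = "\<lambda>s. {a \<in> ?I. fst (\<phi> (n + 1) a) s = \<zero>\<^bsub>M s\<^esub>}"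
  let ?K = "\<lambda>t. {a \<in> ?I. snd (\<phi> (n + 1) a) t = \<zero>\<^bsub>M' t\<^esub>}"
  let ?Q = "(x <#\<^bsub>R\<^esub> PG n) <+>\<^bsub>R\<^esub> PG (n + 2)"
  have QG: "QG (n + 1) = PG (n + 2)" by (simp add: numeral_2_eq_2)
  \<comment> \<open>Multiples of basis vectors by \<open>m\<close> have zero class, so all coordinates are linear over \<open>R / m\<close>.\<close>
  have mI: "c \<otimes> a \<in> QG (n + 1)" if "c \<in> m" "a \<in> ?I" for c a
    using ideal_pow_mult[OF m_ideal, of c 1 a "n + 1"] that unfolding ideal_pow_1[OF m_ideal] by simp
  have "\<forall>s\<in>?S. \<exists>a. a \<in> ?I \<and> (\<forall>s'\<in>S. fst (\<phi> (n + 1) a) s' = (if s' = s then u s else \<zero>\<^bsub>M s'\<^esub>))"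
  proof
    fix s assume "s \<in> ?S"
    then have us: "u s \<in> hcomp (M s) (n + 1)" using cyclic_summand.u_hcomp[OF cyclic_S, of s] by simp
    have "\<exists>a\<in>?I. (\<forall>s'\<in>S. fst (\<phi> (n + 1) a) s' = (if s' = s then u s else \<zero>\<^bsub>M s'\<^esub>)) \<and>
      (\<forall>t\<in>T. snd (\<phi> (n + 1) a) t = \<zero>\<^bsub>M' t\<^esub>)"
    proof (rule lift_coordinates)
      show "(if s' = s then u s else \<zero>\<^bsub>M s'\<^esub>) \<in> hcomp (M s') (n + 1)" if "s' \<in> S" for s'
        using us zero_S[OF that, of "n + 1"] by simp
    qed (rule zero_T)
    then show "\<exists>a. a \<in> ?I \<and> (\<forall>s'\<in>S. fst (\<phi> (n + 1) a) s' = (if s' = s then u s else \<zero>\<^bsub>M s'\<^esub>))"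
      by blast
  qed
  from bchoice[OF this] obtain e where
    "\<forall>s\<in>?S. e s \<in> ?I \<and> (\<forall>s'\<in>S. fst (\<phi> (n + 1) (e s)) s' = (if s' = s then u s else \<zero>\<^bsub>M s'\<^esub>))" ..
  then have e: "\<And>s. s \<in> ?S \<Longrightarrow> e s \<in> ?I"
    "\<And>s s'. s \<in> ?S \<Longrightarrow> s' \<in> S \<Longrightarrow> fst (\<phi> (n + 1) (e s)) s' = (if s' = s then u s else \<zero>\<^bsub>M s'\<^esub>)"
    by simp_all
  have "\<forall>t\<in>?T. \<exists>a. a \<in> ?I \<and> (\<forall>s\<in>S. fst (\<phi> (n + 1) a) s = \<zero>\<^bsub>M s\<^esub>) \<and>
      (\<forall>t'\<in>T. snd (\<phi> (n + 1) a) t' = (if t' = t then u' t else \<zero>\<^bsub>M' t'\<^esub>))"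
  proof
    fix t assume "t \<in> ?T"
    then have ut: "u' t \<in> hcomp (M' t) (n + 1)" using cyclic_summand.u_hcomp[OF cyclic_T, of t] by simp
    have "\<exists>a\<in>?I. (\<forall>s\<in>S. fst (\<phi> (n + 1) a) s = \<zero>\<^bsub>M s\<^esub>) \<and>
      (\<forall>t'\<in>T. snd (\<phi> (n + 1) a) t' = (if t' = t then u' t else \<zero>\<^bsub>M' t'\<^esub>))"
    proof (rule lift_coordinates)
      show "(if t' = t then u' t else \<zero>\<^bsub>M' t'\<^esub>) \<in> hcomp (M' t') (n + 1)" if "t' \<in> T" for t'
        using ut zero_T[OF that, of "n + 1"] by simp
    qed (rule zero_S)
    then show "\<exists>a. a \<in> ?I \<and> (\<forall>s\<in>S. fst (\<phi> (n + 1) a) s = \<zero>\<^bsub>M s\<^esub>) \<and>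
      (\<forall>t'\<in>T. snd (\<phi> (n + 1) a) t' = (if t' = t then u' t else \<zero>\<^bsub>M' t'\<^esub>))"
      by blast
  qed
  from bchoice[OF this] obtain e' where
    "\<forall>t\<in>?T. e' t \<in> ?I \<and> (\<forall>s\<in>S. fst (\<phi> (n + 1) (e' t)) s = \<zero>\<^bsub>M s\<^esub>) \<and>
      (\<forall>t'\<in>T. snd (\<phi> (n + 1) (e' t)) t' = (if t' = t then u' t else \<zero>\<^bsub>M' t'\<^esub>))" ..
  then have e': "\<And>t. t \<in> ?T \<Longrightarrow> e' t \<in> ?I"
    "\<And>t s. t \<in> ?T \<Longrightarrow> s \<in> S \<Longrightarrow> fst (\<phi> (n + 1) (e' t)) s = \<zero>\<^bsub>M s\<^esub>"
    "\<And>t t'. t \<in> ?T \<Longrightarrow> t' \<in> T \<Longrightarrow> snd (\<phi> (n + 1) (e' t)) t' = (if t' = t then u' t else \<zero>\<^bsub>M' t'\<^esub>)"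
    by simp_all
  have red: "a \<ominus> c \<otimes> b \<in> ?I" if "a \<in> ?I" "b \<in> ?I" "c \<in> carrier R" for a b c
    using ideal_diff_closed[OF G.P_ideal that(1) ideal.I_l_closed[OF G.P_ideal that(2,3)]] .
  let ?I' = "?I \<inter> (\<Inter>s\<in>?S. ?H s)" and ?I'' = "?I \<inter> (\<Inter>s\<in>?S. ?H s) \<inter> (\<Inter>t\<in>?T. ?K t)"
  have 1: "ideal ?I' R \<and> interval_length R ?I' ?I = enat (card ?S)"
  proof (rule interval_length_coordinates[OF max, where e = e])
    show "finite ?S" using finite_S by simp
    show "ideal ?I R" by (rule G.P_ideal)
    show "ideal (?H s) R" if "s \<in> ?S" for s
      using summand_coordinate.kernel_ideal[OF coordinate_S, of s "n + 1"] that by simp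
    show "e s \<in> ?I" if "s \<in> ?S" for s using e(1)[OF that] .
    show "e s \<notin> ?H s" if "s \<in> ?S" for s
      using e(2)[OF that, of s] cyclic_summand.u_nonzero[OF cyclic_S, of s] that by simp
    show "e s \<in> ?H s'" if "s \<in> ?S" "s' \<in> ?S" "s \<noteq> s'" for s s'
      using e(1)[OF that(1)] e(2)[OF that(1), of s'] that by simp
    show "c \<otimes> e s \<in> ?H s" if "s \<in> ?S" "c \<in> m" for s c
      using mI[OF that(2) e(1)[OF that(1)]] G.Q_sub[of "n + 1"]
        summand_coordinate.\<phi>_QG[OF coordinate_S, of s "c \<otimes> e s" "n + 1"] that(1) by auto
    show "\<exists>c\<in>carrier R. a \<ominus> c \<otimes> e s \<in> ?H s" if "s \<in> ?S" "a \<in> ?I" for s a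
      using summand_coordinate.\<phi>_reduce[OF coordinate_S, of s a "e s"] e(1)[OF that(1)] e(2)[OF that(1), of s]
        that red[OF that(2) e(1)[OF that(1)]] by auto
  qed
  have 2: "ideal ?I'' R \<and> interval_length R ?I'' ?I' = enat (card ?T)"
  proof (rule interval_length_coordinates[OF max, where e = e'])
    show "finite ?T" using finite_T by simp
    show "ideal ?I' R" using 1 by blast
    show "ideal (?K t) R" if "t \<in> ?T" for t
      using summand_coordinate.kernel_ideal[OF coordinate_T, of t "n + 1"] that by simp
    show "e' t \<in> ?I'" if "t \<in> ?T" for t using e'(1,2)[OF that] by auto
    show "e' t \<notin> ?K t" if "t \<in> ?T" for t
      using e'(3)[OF that, of t] cyclic_summand.u_nonzero[OF cyclic_T, of t] that by simp
    show "e' t \<in> ?K t'" if "t \<in> ?T" "t' \<in> ?T" "t \<noteq> t'" for t t'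
      using e'(1)[OF that(1)] e'(3)[OF that(1), of t'] that by simp
    show "c \<otimes> e' t \<in> ?K t" if "t \<in> ?T" "c \<in> m" for t c
      using mI[OF that(2) e'(1)[OF that(1)]] G.Q_sub[of "n + 1"]
        summand_coordinate.\<phi>_QG[OF coordinate_T, of t "c \<otimes> e' t" "n + 1"] that(1) by auto
    show "\<exists>c\<in>carrier R. a \<ominus> c \<otimes> e' t \<in> ?K t" if "t \<in> ?T" "a \<in> ?I'" for t a
      using summand_coordinate.\<phi>_reduce[OF coordinate_T, of t a "e' t"] e'(1)[OF that(1)] e'(3)[OF that(1), of t]
        that red[OF _ e'(1)[OF that(1)], of a] by auto
  qed
  \<comment> \<open>Killing the coordinates at generators of degree \<open>n + 1\<close> makes every coordinate divisible by
    \<open>x\<^sup>*\<close>; lifting the quotients to one \<open>b \<in> m\<^sup>n\<close> yields \<open>a \<equiv> x b\<close> modulo \<open>m\<^sup>n\<^sup>+\<^sup>2\<close>.\<close>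
  have "?I'' = ?Q"
  proof
    show "?I'' \<subseteq> ?Q"
    proof
      fix a assume "a \<in> ?I''"
      then have a: "a \<in> ?I" "\<And>s. s \<in> S \<Longrightarrow> d s = n + 1 \<Longrightarrow> fst (\<phi> (n + 1) a) s = \<zero>\<^bsub>M s\<^esub>"
        "\<And>t. t \<in> T \<Longrightarrow> d' t = n + 1 \<Longrightarrow> snd (\<phi> (n + 1) a) t = \<zero>\<^bsub>M' t\<^esub>" by auto
      have "\<forall>s\<in>S. \<exists>z\<in>hcomp (M s) n. fst (\<phi> (n + 1) a) s = xstar \<odot>\<^bsub>M s\<^esub> z"
        using summand_coordinate.\<phi>_xstar_multiple[OF coordinate_S, of _ a n] a by simp
      then obtain f where f: "\<And>s. s \<in> S \<Longrightarrow> f s \<in> hcomp (M s) n"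
        "\<And>s. s \<in> S \<Longrightarrow> fst (\<phi> (n + 1) a) s = xstar \<odot>\<^bsub>M s\<^esub> f s" by metis
      have "\<forall>t\<in>T. \<exists>z\<in>hcomp (M' t) n. snd (\<phi> (n + 1) a) t = xstar \<odot>\<^bsub>M' t\<^esub> z"
        using summand_coordinate.\<phi>_xstar_multiple[OF coordinate_T, of _ a n] a by simp
      then obtain g where g: "\<And>t. t \<in> T \<Longrightarrow> g t \<in> hcomp (M' t) n"
        "\<And>t. t \<in> T \<Longrightarrow> snd (\<phi> (n + 1) a) t = xstar \<odot>\<^bsub>M' t\<^esub> g t" by metis
      obtain b where b: "b \<in> PG n" "\<And>s. s \<in> S \<Longrightarrow> fst (\<phi> n b) s = f s" "\<And>t. t \<in> T \<Longrightarrow> snd (\<phi> n b) t = g t"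
        using lift_coordinates[of f n g] f(1) g(1) by blast
      have xb: "x \<otimes> b \<in> PG (n + 1)"
        using ideal_pow_mult[OF m_ideal, of x 1 b n] x_mem b(1) unfolding ideal_pow_1[OF m_ideal] by simp
      have "a \<ominus> x \<otimes> b \<in> QG (n + 1)"
      proof (rule coordinates_ext[OF a(1) xb])
        show "fst (\<phi> (n + 1) a) s = fst (\<phi> (n + 1) (x \<otimes> b)) s" if "s \<in> S" for s
          using summand_coordinate.\<phi>_xstar[OF coordinate_S[OF that] b(1)] f(2)[OF that] b(2)[OF that] by simp
        show "snd (\<phi> (n + 1) a) t = snd (\<phi> (n + 1) (x \<otimes> b)) t" if "t \<in> T" for t
          using summand_coordinate.\<phi>_xstar[OF coordinate_T[OF that] b(1)] g(2)[OF that] b(3)[OF that] by simp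
      qed
      moreover have "a = x \<otimes> b \<oplus> (a \<ominus> x \<otimes> b)"
      proof -
        have "a \<in> carrier R" "x \<otimes> b \<in> carrier R" using G.P_carrier a(1) xb by blast+
        then show ?thesis by (simp add: a_minus_def a_lcomm r_neg)
      qed
      moreover have "x \<otimes> b \<in> x <#\<^bsub>R\<^esub> PG n" using b(1) by (auto simp: l_coset_def)
      ultimately show "a \<in> ?Q" unfolding QG set_add_def' by blast
    qed
    show "?Q \<subseteq> ?I''"
    proof (rule set_add_least)
      show "ideal ?I'' R" using 2 by blast
      show "x <#\<^bsub>R\<^esub> PG n \<subseteq> ?I''"
      proof
        fix a assume "a \<in> x <#\<^bsub>R\<^esub> PG n"
        then obtain b where b: "b \<in> PG n" "a = x \<otimes> b" by (auto simp: l_coset_def)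
        have "a \<in> ?I"
          using ideal_pow_mult[OF m_ideal, of x 1 b n] x_mem b unfolding ideal_pow_1[OF m_ideal] by simp
        then show "a \<in> ?I''"
          using summand_coordinate.\<phi>_xstar_image[OF coordinate_S b(1)]
            summand_coordinate.\<phi>_xstar_image[OF coordinate_T b(1)] b(2) by auto
      qed
      show "PG (n + 2) \<subseteq> ?I''"
      proof
        fix a assume "a \<in> PG (n + 2)"
        then have "a \<in> QG (n + 1)" unfolding QG .
        then show "a \<in> ?I''"
          using G.Q_sub[of "n + 1"] summand_coordinate.\<phi>_QG[OF coordinate_S, of _ a "n + 1"]
            summand_coordinate.\<phi>_QG[OF coordinate_T, of _ a "n + 1"] by auto
      qed
    qed
  qed
  moreover have "interval_length R ?I'' ?I = interval_length R ?I'' ?I' + interval_length R ?I' ?I"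
    by (rule interval_length_add) (use 1 2 G.P_ideal in auto)
  ultimately show ?thesis using 1 2 by (simp add: add.commute)
qed

text \<open>An element of a torsion summand killed by \<open>x\<^sup>*\<close>, transported back to the tangent cone, is the
  class of a ring element whose order rises by more than one on multiplication by \<open>x\<close>.\<close>

lemma torsion_coordinate:
  assumes t: "t \<in> T" and w: "w \<in> hcomp (M' t) n" "w \<noteq> \<zero>\<^bsub>M' t\<^esub>" "xstar \<odot>\<^bsub>M' t\<^esub> w = \<zero>\<^bsub>M' t\<^esub>"
  shows "\<exists>b\<in>PG n. b \<notin> PG (n + 1) \<and> x \<otimes> b \<in> PG (n + 2)"
proof -
  note [simp del] = Group.nat_pow_Suc
  have "\<exists>b\<in>PG n. (\<forall>s\<in>S. fst (\<phi> n b) s = \<zero>\<^bsub>M s\<^esub>) \<and>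
    (\<forall>t'\<in>T. snd (\<phi> n b) t' = (if t' = t then w else \<zero>\<^bsub>M' t'\<^esub>))"
  proof (rule lift_coordinates)
    show "(if t' = t then w else \<zero>\<^bsub>M' t'\<^esub>) \<in> hcomp (M' t') n" if "t' \<in> T" for t'
      using w(1) zero_T[OF that, of n] by simp
  qed (rule zero_S)
  then obtain b where b: "b \<in> PG n" "\<And>s. s \<in> S \<Longrightarrow> fst (\<phi> n b) s = \<zero>\<^bsub>M s\<^esub>"
    "\<And>t'. t' \<in> T \<Longrightarrow> snd (\<phi> n b) t' = (if t' = t then w else \<zero>\<^bsub>M' t'\<^esub>)"
    by blast
  have xb: "x \<otimes> b \<in> PG (Suc n)"
    using ideal_pow_mult[OF m_ideal, of x 1 b n] x_mem b(1) unfolding ideal_pow_1[OF m_ideal] by simp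
  have "x \<otimes> b \<ominus> \<zero> \<in> QG (Suc n)"
  proof (rule coordinates_ext[OF xb G.P_zero])
    show "fst (\<phi> (Suc n) (x \<otimes> b)) s = fst (\<phi> (Suc n) \<zero>) s" if s: "s \<in> S" for s
      using summand_coordinate.\<phi>_xstar[OF coordinate_S[OF s] b(1)] b(2)[OF s]
        cyclic_summand.xstar_smult_zero[OF cyclic_S[OF s]] summand_coordinate.\<phi>_zero[OF coordinate_S[OF s], of "Suc n"]
      by simp
    show "snd (\<phi> (Suc n) (x \<otimes> b)) t' = snd (\<phi> (Suc n) \<zero>) t'" if t': "t' \<in> T" for t'
      using summand_coordinate.\<phi>_xstar[OF coordinate_T[OF t'] b(1)] b(3)[OF t'] w(3)
        cyclic_summand.xstar_smult_zero[OF cyclic_T[OF t']] summand_coordinate.\<phi>_zero[OF coordinate_T[OF t'], of "Suc n"]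
      by (simp split: if_splits)
  qed
  moreover have "x \<otimes> b \<ominus> \<zero> = x \<otimes> b" using G.P_carrier[OF xb] by (simp add: a_minus_def)
  ultimately have "x \<otimes> b \<in> PG (n + 2)" by (simp add: numeral_2_eq_2)
  moreover have "b \<notin> PG (n + 1)"
    using summand_coordinate.\<phi>_QG[OF coordinate_T[OF t], of b n] b(3)[OF t] w(2) by auto
  ultimately show ?thesis using b(1) by blast
qed

end

section \<open>Nonzerodivisors and the Apery invariants\<close>

context cring
begin

lemma genideal_empty: "Idl {} = {\<zero>}"
proof
  show "Idl {} \<subseteq> {\<zero>}" using genideal_minimal[OF zeroideal] by simp
  have "ideal (Idl {}) R" by (rule genideal_ideal) simp
  then show "{\<zero>} \<subseteq> Idl {}" using additive_subgroup.zero_closed[OF ideal.axioms(1)] by simp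
qed

text \<open>A nonempty regular sequence starts with a nonzerodivisor, since the ideal generated by the
  entries before the first one is zero.\<close>

lemma nonzerodivisor_of_depth:
  assumes "depth R m \<noteq> 0"
  obtains y where "y \<in> m" "y \<in> carrier R" "\<And>a. a \<in> carrier R \<Longrightarrow> y \<otimes> a = \<zero> \<Longrightarrow> a = \<zero>"
proof -
  have "\<exists>xs. set xs \<subseteq> m \<and> regular_sequence R xs \<and> xs \<noteq> []"
  proof (rule ccontr)
    assume "\<not> ?thesis"
    then have "depth R m \<le> 0"
      unfolding depth_def by (intro Sup_least) (auto simp: zero_enat_def)
    then show False using assms by simp
  qed
  then obtain xs where xs: "set xs \<subseteq> m" "regular_sequence R xs" "xs \<noteq> []" by blast
  have mem: "xs ! 0 \<in> set xs" using xs(3) by simp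
  have "\<forall>i<length xs. \<forall>a\<in>carrier R. xs ! i \<otimes> a \<in> Idl (set (take i xs)) \<longrightarrow> a \<in> Idl (set (take i xs))"
    using xs(2) by (simp add: regular_sequence_def)
  moreover have "0 < length xs" using xs(3) by simp
  ultimately have "\<forall>a\<in>carrier R. xs ! 0 \<otimes> a \<in> Idl (set (take 0 xs)) \<longrightarrow> a \<in> Idl (set (take 0 xs))"
    by blast
  then have nzd: "\<forall>a\<in>carrier R. xs ! 0 \<otimes> a = \<zero> \<longrightarrow> a = \<zero>" by (simp add: genideal_empty)
  show ?thesis
  proof (rule that)
    show "xs ! 0 \<in> m" using xs(1) mem by (rule subsetD)
    show "xs ! 0 \<in> carrier R" using xs(2) mem by (auto simp: regular_sequence_def)
    show "a = \<zero>" if "a \<in> carrier R" "xs ! 0 \<otimes> a = \<zero>" for a using nzd that by simp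
  qed
qed

text \<open>From \<open>y\<^sup>n\<^sup>+\<^sup>1 \<in> m\<^sup>n\<^sup>+\<^sup>1 = x m\<^sup>n\<close>, the element \<open>x\<close> divides a power of the nonzerodivisor \<open>y\<close>.\<close>

lemma nonzerodivisor_of_reduction:
  assumes m: "ideal m R" and x: "x \<in> carrier R"
    and red: "ideal_pow R m (n + 1) = x <#\<^bsub>R\<^esub> ideal_pow R m n"
    and y: "y \<in> m" "\<And>a. a \<in> carrier R \<Longrightarrow> y \<otimes> a = \<zero> \<Longrightarrow> a = \<zero>"
    and a: "a \<in> carrier R" "x \<otimes> a = \<zero>"
  shows "a = \<zero>"
proof -
  have yc: "y \<in> carrier R" using y(1) ideal_subset[OF m] by blast
  have pow: "b = \<zero>" if "b \<in> carrier R" "y [^] k \<otimes> b = \<zero>" for k :: nat and b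
    using that
  proof (induction k)
    case (Suc k)
    have "y [^] Suc k \<otimes> b = y \<otimes> (y [^] k \<otimes> b)" using Suc.prems(1) yc by (simp add: m_ac)
    then have "y [^] k \<otimes> b = \<zero>" using Suc.prems yc y(2)[of "y [^] k \<otimes> b"] by simp
    then show ?case using Suc by simp
  qed simp
  have "y [^] (n + 1) \<in> x <#\<^bsub>R\<^esub> ideal_pow R m n"
    using pow_mem_ideal_pow[OF m y(1), of "n + 1"] unfolding red .
  then obtain z where z: "z \<in> ideal_pow R m n" "y [^] (n + 1) = x \<otimes> z" by (auto simp: l_coset_def)
  have zc: "z \<in> carrier R" using z(1) ideal_subset[OF ideal_pow_ideal[OF m]] by blast
  have "y [^] (n + 1) \<otimes> a = z \<otimes> (x \<otimes> a)" unfolding z(2) using x zc a(1) by (simp add: m_ac)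
  then have "y [^] (n + 1) \<otimes> a = \<zero>" using a(2) zc by simp
  then show ?thesis by (rule pow[OF a(1)])
qed

lemma modular_law:
  assumes "ideal B R" "ideal C R" "ideal D R" "B \<subseteq> C"
  shows "C \<inter> (B <+>\<^bsub>R\<^esub> D) = (C \<inter> D) <+>\<^bsub>R\<^esub> B"
proof
  show "C \<inter> (B <+>\<^bsub>R\<^esub> D) \<subseteq> (C \<inter> D) <+>\<^bsub>R\<^esub> B"
  proof
    fix y assume y: "y \<in> C \<inter> (B <+>\<^bsub>R\<^esub> D)"
    then obtain b e where be: "b \<in> B" "e \<in> D" "y = b \<oplus> e" by (auto elim: set_addE)
    have c: "b \<in> carrier R" "e \<in> carrier R" using be ideal_subset assms by blast+
    have "y \<ominus> b \<in> C" by (rule ideal_diff_closed) (use assms y be in auto)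
    moreover have "y \<ominus> b = e" unfolding be(3) using c by algebra
    ultimately have "e \<in> C \<inter> D" using be by simp
    moreover have "y = e \<oplus> b" unfolding be(3) using c by (simp add: a_comm)
    ultimately show "y \<in> (C \<inter> D) <+>\<^bsub>R\<^esub> B" using be unfolding set_add_def' by blast
  qed
  have "ideal (B <+>\<^bsub>R\<^esub> D) R" using add_ideals assms by blast
  then show "(C \<inter> D) <+>\<^bsub>R\<^esub> B \<subseteq> C \<inter> (B <+>\<^bsub>R\<^esub> D)"
    using assms set_add_upper[OF assms(1,3)] by (intro set_add_least i_intersect) auto
qed

text \<open>The Apery invariant is the length of \<open>m\<^sup>n\<^sup>+\<^sup>1 / P\<close>, where \<open>P\<close> is the intersection of \<open>m\<^sup>n\<^sup>+\<^sup>1\<close> with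
  \<open>m\<^sup>n\<^sup>+\<^sup>2 + xA\<close>. By the modular law \<open>P\<close> is also the numerator of the second quotient.\<close>

lemma apery_plus_intersection:
  assumes m: "ideal m R" and x: "x \<in> m"
  shows "apery_invariant R m x (n + 1) +
      quot_length R ((ideal_pow R m (n + 1) \<inter> PIdl x) <+>\<^bsub>R\<^esub> ideal_pow R m (n + 2))
        ((x <#\<^bsub>R\<^esub> ideal_pow R m n) <+>\<^bsub>R\<^esub> ideal_pow R m (n + 2)) =
    interval_length R ((x <#\<^bsub>R\<^esub> ideal_pow R m n) <+>\<^bsub>R\<^esub> ideal_pow R m (n + 2)) (ideal_pow R m (n + 1))"
proof -
  let ?X = "PIdl x" and ?C = "ideal_pow R m (n + 1)" and ?D = "ideal_pow R m (n + 2)"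
  let ?B = "?D <+>\<^bsub>R\<^esub> ?X" and ?P = "(?C \<inter> ?X) <+>\<^bsub>R\<^esub> ?D"
  let ?Q = "(x <#\<^bsub>R\<^esub> ideal_pow R m n) <+>\<^bsub>R\<^esub> ?D"
  have xc: "x \<in> carrier R" using ideal_subset[OF m] x by blast
  have X: "ideal ?X R" using cgenideal_ideal[OF xc] .
  have C: "ideal ?C R" and D: "ideal ?D R" using ideal_pow_ideal[OF m] by blast+
  have DC: "?D \<subseteq> ?C" using ideal_pow_Suc_sub[OF m, of "n + 1"] by (simp only: Suc_eq_plus1 add.assoc one_add_one)
  have B: "ideal ?B R" using add_ideals[OF D X] .
  have P: "ideal ?P R" using add_ideals[OF i_intersect[OF C X] D] .
  have xm: "ideal (x <#\<^bsub>R\<^esub> ideal_pow R m n) R" by (rule l_coset_ideal[OF ideal_pow_ideal[OF m] xc])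
  have Q: "ideal ?Q R" using add_ideals[OF xm D] .
  have sum: "?B <+>\<^bsub>R\<^esub> ?C = ?C <+>\<^bsub>R\<^esub> ?X"
  proof
    have CX: "ideal (?C <+>\<^bsub>R\<^esub> ?X) R" using add_ideals[OF C X] .
    have BC: "ideal (?B <+>\<^bsub>R\<^esub> ?C) R" using add_ideals[OF B C] .
    note up = set_add_upper[OF C X] set_add_upper[OF D X] set_add_upper[OF B C]
    have "?B \<subseteq> ?C <+>\<^bsub>R\<^esub> ?X" by (rule set_add_least[OF CX]) (use up DC in blast)+
    then show "?B <+>\<^bsub>R\<^esub> ?C \<subseteq> ?C <+>\<^bsub>R\<^esub> ?X" by (rule set_add_least[OF CX]) (use up in blast)
    show "?C <+>\<^bsub>R\<^esub> ?X \<subseteq> ?B <+>\<^bsub>R\<^esub> ?C" by (rule set_add_least[OF BC]) (use up in blast)+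
  qed
  have BP: "?B \<inter> ?C = ?P" using modular_law[OF D C X DC] by blast
  have PC: "?P \<subseteq> ?C" unfolding BP[symmetric] by blast
  have "x <#\<^bsub>R\<^esub> ideal_pow R m n \<subseteq> ?C \<inter> ?X"
  proof
    fix a assume "a \<in> x <#\<^bsub>R\<^esub> ideal_pow R m n"
    then obtain b where b: "b \<in> ideal_pow R m n" "a = x \<otimes> b" by (auto simp: l_coset_def)
    have bc: "b \<in> carrier R" using b(1) ideal_subset[OF ideal_pow_ideal[OF m]] by blast
    have "b \<otimes> x \<in> ideal_pow R m (n + 1)"
      by (rule ideal_pow_mult[OF m b(1)]) (use x ideal_pow_1[OF m] in \<open>simp del: Group.nat_pow_Suc\<close>)
    moreover have "a = b \<otimes> x" using b(2) bc xc by (simp add: m_comm)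
    ultimately show "a \<in> ?C \<inter> ?X" using bc unfolding cgenideal_def by blast
  qed
  then have QP: "?Q \<subseteq> ?P"
    using set_add_upper[OF i_intersect[OF C X] D] by (intro set_add_least[OF P]) blast+
  have "?B \<subseteq> ?C <+>\<^bsub>R\<^esub> ?X" using set_add_upper(1)[OF B C] unfolding sum .
  then have "apery_invariant R m x (n + 1) = interval_length R ?B (?C <+>\<^bsub>R\<^esub> ?X)"
    unfolding apery_invariant_def using quot_length_eq_interval_length[OF add_ideals[OF C X] B]
    by (simp only: add.assoc one_add_one)
  also have "\<dots> = interval_length R ?P ?C" using interval_length_sum[OF B C] unfolding sum BP .
  finally show ?thesis
    using quot_length_eq_interval_length[OF P Q QP] interval_length_add[OF Q P C QP PC] by (simp add: add.commute)
qed

end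


section \<open>The formula\<close>

theorem proposition3p3:
  fixes A :: "('a, 'b) ring_scheme" and m :: "'a set" and x :: 'a
    and \<alpha> :: "nat \<Rightarrow> nat" and \<beta> :: "nat \<Rightarrow> nat \<Rightarrow> nat" and r i :: nat
  assumes "cohen_macaulay_local_ring A m"
    and "krull_dim A = 1"
    and "infinite (carrier (A Quot m))"
    and "minimal_reduction A m x"
    and "r = reduction_number A m x"
    and "tangent_cone_invariants A m x \<alpha> \<beta>"
    and "1 \<le> i" and "i \<le> r"
  shows "enat (\<alpha> i + (\<Sum>j = 1..r - i - 1. \<beta> i j)) =
    apery_invariant A m x i +
    quot_length A ((ideal_pow A m i \<inter> PIdl\<^bsub>A\<^esub> x) <+>\<^bsub>A\<^esub> ideal_pow A m (i + 1))
      ((x <#\<^bsub>A\<^esub> ideal_pow A m (i - 1)) <+>\<^bsub>A\<^esub> ideal_pow A m (i + 1))"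
proof -
  note [simp del] = Group.nat_pow_Suc
  have local: "noetherian_local_ring A m" and depth: "depth A m = 1"
    using assms(1,2) by (simp_all add: cohen_macaulay_local_ring_def)
  interpret cring A using local by (rule noetherian_local_ring.axioms(2))
  have max: "maximalideal m A" using noetherian_local_ring.maximalideal_iff[OF local] by simp
  then have m: "ideal m A" by (rule maximalideal.axioms(1))
  have x: "x \<in> m" using assms(4) by (simp add: minimal_reduction_def)
  then have xc: "x \<in> carrier A" using ideal_subset[OF m] by blast
  have red: "ideal_pow A m (r + 1) = x <#\<^bsub>A\<^esub> ideal_pow A m r"
    using assms(4) LeastI_ex[of "\<lambda>n. ideal_pow A m (n + 1) = x <#\<^bsub>A\<^esub> ideal_pow A m n"]
    by (simp add: minimal_reduction_def reduction_number_def assms(5))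
  obtain y where y: "y \<in> m" "y \<in> carrier A" "\<And>a. a \<in> carrier A \<Longrightarrow> y \<otimes>\<^bsub>A\<^esub> a = \<zero>\<^bsub>A\<^esub> \<Longrightarrow> a = \<zero>\<^bsub>A\<^esub>"
    using nonzerodivisor_of_depth[of m] depth by auto
  interpret nonzerodivisor_in_maximal A m x
  proof (rule nonzerodivisor_in_maximal.intro[OF is_cring nonzerodivisor_in_maximal_axioms.intro[OF max x]])
    show "a = \<zero>\<^bsub>A\<^esub>" if "a \<in> carrier A" "x \<otimes>\<^bsub>A\<^esub> a = \<zero>\<^bsub>A\<^esub>" for a
      by (rule nonzerodivisor_of_reduction[OF m xc red y(1,3) that])
  qed
  let ?S = "{(i, k). i \<le> r \<and> k < \<alpha> i}" and ?M = "\<lambda>(i, k). gshift F i"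
  let ?T = "{(i, j, k). i \<in> {1..r - 1} \<and> j \<in> {1..r - i} \<and> k < \<beta> i j}"
  let ?M' = "\<lambda>(i, j, k). gshift (gquot F (N j)) i"
  interpret D: tangent_cone_decomposition A m x ?S ?M fst "\<lambda>_. cst \<one>\<^bsub>A\<^esub>" ?T ?M' fst
    "\<lambda>(i, j, k). N j +>\<^bsub>F\<^esub> cst \<one>\<^bsub>A\<^esub>"
  proof (rule tangent_cone_decomposition.intro[OF nonzerodivisor_in_maximal_axioms
        tangent_cone_decomposition_axioms.intro])
    have "?S = (SIGMA i:{..r}. {..<\<alpha> i})" by auto
    then show "finite ?S" by simp
    have "?T = (SIGMA i:{1..r - 1}. SIGMA j:{1..r - i}. {..<\<beta> i j})" by auto
    then show "finite ?T" by simp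
    show "cyclic_summand A m x (?M s) (fst s) (cst \<one>\<^bsub>A\<^esub>)" for s
      using cyclic_summand_free by (simp add: case_prod_beta)
    show "cyclic_summand A m x (?M' t) (fst t) (case t of (i, j, k) \<Rightarrow> N j +>\<^bsub>F\<^esub> cst \<one>\<^bsub>A\<^esub>)"
      if "t \<in> ?T" for t
      using that cyclic_summand_torsion by auto
    show "gmodule_iso F G (gdirect_sum2 (gdirect_sum ?S ?M) (gdirect_sum ?T ?M'))"
      using assms(6) unfolding tangent_cone_invariants_def Let_def PIdl_xstar_pow assms(5)[symmetric] .
  qed
  \<comment> \<open>The sum in the formula stops at \<open>r - i - 1\<close>, one short of the decomposition. The missing
    summand would have \<open>x\<^sup>*\<close>-torsion in degree \<open>r - 1\<close>, where multiplication by \<open>x\<^sup>*\<close> is injective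
    because \<open>m\<^sup>r\<^sup>+\<^sup>1 = x m\<^sup>r\<close>.\<close>
  have no_torsion: "\<beta> i (r - i) = 0" if ir: "i < r"
  proof (rule ccontr)
    assume "\<beta> i (r - i) \<noteq> 0"
    then have t: "(i, r - i, 0) \<in> ?T" using ir assms(7) by auto
    have one_le: "1 \<le> r - i" using ir by simp
    obtain w where "w \<in> hcomp (gshift (gquot F (N (r - i))) i) (i + (r - i - 1))"
      "w \<noteq> \<zero>\<^bsub>gshift (gquot F (N (r - i))) i\<^esub>"
      "xstar \<odot>\<^bsub>gshift (gquot F (N (r - i))) i\<^esub> w = \<zero>\<^bsub>gshift (gquot F (N (r - i))) i\<^esub>"
      using torsion_element[of "r - i" i] one_le by blast
    then have "\<exists>b\<in>PG (i + (r - i - 1)). b \<notin> PG (i + (r - i - 1) + 1) \<and> x \<otimes>\<^bsub>A\<^esub> b \<in> PG (i + (r - i - 1) + 2)"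
      by (intro D.torsion_coordinate[OF t]) simp_all
    moreover have "i + (r - i - 1) + 1 = r" "i + (r - i - 1) + 2 = r + 1" using ir by auto
    ultimately obtain b where b: "b \<in> PG (i + (r - i - 1))" "b \<notin> PG r" "x \<otimes>\<^bsub>A\<^esub> b \<in> PG (r + 1)"
      by auto
    obtain c where c: "c \<in> PG r" "x \<otimes>\<^bsub>A\<^esub> b = x \<otimes>\<^bsub>A\<^esub> c" using b(3) unfolding red by (auto simp: l_coset_def)
    have bc: "b \<in> carrier A" "c \<in> carrier A" using G.P_carrier b(1) c(1) by blast+
    have "x \<otimes>\<^bsub>A\<^esub> (b \<ominus>\<^bsub>A\<^esub> c) = x \<otimes>\<^bsub>A\<^esub> b \<ominus>\<^bsub>A\<^esub> x \<otimes>\<^bsub>A\<^esub> c"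
      using bc xc by (simp add: a_minus_def r_distr r_minus)
    then have "x \<otimes>\<^bsub>A\<^esub> (b \<ominus>\<^bsub>A\<^esub> c) = \<zero>\<^bsub>A\<^esub>" using c(2) bc xc by (simp add: a_minus_def r_neg)
    then have "b \<ominus>\<^bsub>A\<^esub> c = \<zero>\<^bsub>A\<^esub>" using nzd[of "b \<ominus>\<^bsub>A\<^esub> c"] bc by simp
    then have "b = c" using bc by simp
    then show False using b(2) c(1) by simp
  qed
  have "{s \<in> ?S. fst s = i} = {i} \<times> {..<\<alpha> i}" using assms(8) by auto
  then have S: "card {s \<in> ?S. fst s = i} = \<alpha> i" by (simp add: card_cartesian_product)
  have T: "card {t \<in> ?T. fst t = i} = (\<Sum>j = 1..r - i - 1. \<beta> i j)"
  proof (cases "i < r")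
    case True
    then have "{t \<in> ?T. fst t = i} = {i} \<times> (SIGMA j:{1..r - i}. {..<\<beta> i j})" using assms(7) by auto
    then have "card {t \<in> ?T. fst t = i} = (\<Sum>j = 1..r - i. \<beta> i j)" by (simp add: card_cartesian_product)
    also have "{1..r - i} = insert (r - i) {1..r - i - 1}" using True by auto
    also have "(\<Sum>j\<in>insert (r - i) {1..r - i - 1}. \<beta> i j) = (\<Sum>j = 1..r - i - 1. \<beta> i j)"
      using True no_torsion[OF True] by (subst sum.insert) auto
    finally show ?thesis .
  next
    case False
    then have T_empty: "{t \<in> ?T. fst t = i} = {}" using assms(7,8) by auto
    show ?thesis unfolding T_empty using False by simp
  qed
  have i: "i = (i - 1) + 1" "i + 1 = (i - 1) + 2" using assms(7) by auto
  have "enat (\<alpha> i + (\<Sum>j = 1..r - i - 1. \<beta> i j)) =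
      interval_length A ((x <#\<^bsub>A\<^esub> PG (i - 1)) <+>\<^bsub>A\<^esub> PG (i + 1)) (PG i)"
    using D.number_of_generators[of "i - 1"] S T unfolding i(1)[symmetric] i(2)[symmetric] by (simp only:)
  also have "\<dots> = apery_invariant A m x i +
    quot_length A ((PG i \<inter> PIdl\<^bsub>A\<^esub> x) <+>\<^bsub>A\<^esub> PG (i + 1)) ((x <#\<^bsub>A\<^esub> PG (i - 1)) <+>\<^bsub>A\<^esub> PG (i + 1))"
    using apery_plus_intersection[OF m x, of "i - 1"] unfolding i(1)[symmetric] i(2)[symmetric] by (rule sym)
  finally show ?thesis .
qed

end
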